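(* Let $g\colon\mathbb{N}\to\mathbb{N}$ be a nondecreasing function with $\liminf_{n\to\infty} g(n)/\log(n)>0$. Then there are a shift space $X$ on a finite alphabet with positive topological entropy, with language $\mathcal{L}$, and a collection $\mathcal{G}\subset\mathcal{L}$ such that $\mathcal{G}^*\subset\mathcal{G}$ and $\mathcal{L}$ is $g$-Hamming approachable by $\mathcal{G}$, but there is a locally constant potential function $X\to\mathbb{R}$ that has a delta measure (a Dirac measure at a point) as its unique equilibrium state.
   Context: $\mathbb{N}=\{1,2,3,\dots\}$. A shift space over a finite alphabet $A$ is a closed subset $X\subset A^{\mathbb{N}}$ invariant under the left shift $\sigma$. Its language $\mathcal{L}$ is the set of all finite words appearing in elements of $X$ (including the empty word); a subscript $n$ denotes the subset of words of length $n$. $\mathcal{G}^*$ is the set of all finite concatenations of words in $\mathcal{G}$. For words $v,w$ of equal length, $d_{\mathrm{Ham}}(v,w)=\#\{i: v_i\neq w_i\}$. $\mathcal{L}$ is $g$-Hamming approachable by $\mathcal{G}\subset\mathcal{L}$ if there is $n_0\in\mathbb{N}$ such that for every $n\ge n_0$ and $w\in\mathcal{L}_n$ there is $v\in\mathcal{G}_n$ with $d_{\mathrm{Ham}}(v,w)\le g(n)$. An equilibrium state for a continuous potential $\varphi\colon X\to\mathbb{R}$ is a $\sigma$-invariant Borel probability measure $\mu$ on $X$ attaining the supremum $\sup_\mu\big(h_\mu(\sigma)+\int\varphi\,d\mu\big)$ over all $\sigma$-invariant Borel probability measures. *)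

theory Defs
  imports "HOL-Probability.Probability"
begin

section \<open>Shift spaces and their languages\<close>

text \<open>
  One-sided sequences are functions on \<^typ>\<open>nat\<close>, index \<open>0\<close> being the first position.
  The topology and the Borel sets of \<^typ>\<open>nat \<Rightarrow> 'a\<close> are those of the product topology, the
  alphabet being discrete.
\<close>

definition shift :: "(nat \<Rightarrow> 'a) \<Rightarrow> nat \<Rightarrow> 'a" where
  "shift x = (\<lambda>n. x (Suc n))"

definition shift_space :: "'a::discrete_topology set \<Rightarrow> (nat \<Rightarrow> 'a) set \<Rightarrow> bool" where
  "shift_space A X \<longleftrightarrow> finite A \<and> X \<subseteq> (UNIV \<rightarrow> A) \<and> closed X \<and> shift ` X \<subseteq> X"

definition language :: "(nat \<Rightarrow> 'a) set \<Rightarrow> 'a list set" where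
  "language X = {map x [i..<j] | x i j. x \<in> X}"

definition words_of_length :: "'a list set \<Rightarrow> nat \<Rightarrow> 'a list set" where
  "words_of_length L n = {w \<in> L. length w = n}"

text \<open>The empty concatenation is allowed.\<close>

definition concatenations :: "'a list set \<Rightarrow> 'a list set" where
  "concatenations G = concat ` lists G"

definition hamming_dist :: "'a list \<Rightarrow> 'a list \<Rightarrow> nat" where
  "hamming_dist v w = card {i. i < length w \<and> v ! i \<noteq> w ! i}"

definition hamming_approachable ::
    "(nat \<Rightarrow> nat) \<Rightarrow> 'a list set \<Rightarrow> 'a list set \<Rightarrow> bool" where
  "hamming_approachable g L G \<longleftrightarrow> G \<subseteq> L \<and>
     (\<exists>n0\<ge>1. \<forall>n\<ge>n0. \<forall>w\<in>words_of_length L n. \<exists>v\<in>words_of_length G n. hamming_dist v w \<le> g n)"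

text \<open>For a shift space over a finite alphabet the limit exists by subadditivity.\<close>

definition topological_entropy :: "(nat \<Rightarrow> 'a) set \<Rightarrow> real" where
  "topological_entropy X = lim (\<lambda>n. ln (real (card (words_of_length (language X) n))) / real n)"


section \<open>Measure-theoretic entropy\<close>

text \<open>
  A finite measurable partition of the space of \<open>M\<close> is given by a simple function \<open>f\<close>, its cells
  being the nonempty fibres of \<open>f\<close>. The cells of the join of the first \<open>n\<close> preimages of
  the partition under \<open>T\<close> are then the nonempty fibres of \<open>itinerary T f n\<close>.
\<close>

definition partition_entropy :: "'x measure \<Rightarrow> ('x \<Rightarrow> 'b) \<Rightarrow> real" where
  "partition_entropy M f = prob_space.entropy M (exp 1) (count_space (f ` space M)) f"

lemma partition_entropy_eq:
  assumes "prob_space M" and f: "simple_function M f"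
  shows "partition_entropy M f =
    - (\<Sum>c\<in>f ` space M. measure M {x \<in> space M. f x = c} * ln (measure M {x \<in> space M. f x = c}))"
proof -
  interpret prob_space M by fact
  interpret information_space M "exp 1" by unfold_locales simp
  have "simple_distributed M f (\<lambda>c. measure M {x \<in> space M. f x = c})"
    by (rule simple_distributedI[OF f]) (auto intro!: arg_cong[where f = "measure M"])
  from entropy_simple_distributed[OF this] show ?thesis
    by (simp add: partition_entropy_def log_def)
qed

definition itinerary :: "('x \<Rightarrow> 'x) \<Rightarrow> ('x \<Rightarrow> 'b) \<Rightarrow> nat \<Rightarrow> 'x \<Rightarrow> 'b list" where
  "itinerary T f n x = map (\<lambda>i. f ((T ^^ i) x)) [0..<n]"

text \<open>For a \<open>T\<close>-invariant probability measure the limit exists by subadditivity.\<close>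

definition entropy_wrt_partition :: "'x measure \<Rightarrow> ('x \<Rightarrow> 'x) \<Rightarrow> ('x \<Rightarrow> 'b) \<Rightarrow> real" where
  "entropy_wrt_partition M T f = lim (\<lambda>n. partition_entropy M (itinerary T f n) / real n)"

text \<open>Cells are labelled by natural numbers, which covers all finite partitions.\<close>

definition measure_entropy :: "'x measure \<Rightarrow> ('x \<Rightarrow> 'x) \<Rightarrow> ereal" where
  "measure_entropy M T =
     (SUP f\<in>{f :: 'x \<Rightarrow> nat. simple_function M f}. ereal (entropy_wrt_partition M T f))"


section \<open>Equilibrium states\<close>

definition invariant_measures :: "(nat \<Rightarrow> 'a::topological_space) set \<Rightarrow> (nat \<Rightarrow> 'a) measure set" where
  "invariant_measures X = {\<mu>. sets \<mu> = sets (restrict_space borel X) \<and> prob_space \<mu> \<and>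
     shift \<in> measurable \<mu> \<mu> \<and> distr \<mu> \<mu> shift = \<mu>}"

text \<open>A potential is a function on all sequences of which only the values on \<open>X\<close> matter.\<close>

definition free_energy ::
    "((nat \<Rightarrow> 'a::topological_space) \<Rightarrow> real) \<Rightarrow> (nat \<Rightarrow> 'a) measure \<Rightarrow> ereal" where
  "free_energy \<phi> \<mu> = measure_entropy \<mu> shift + ereal (\<integral>x. \<phi> x \<partial>\<mu>)"

definition equilibrium_state ::
    "(nat \<Rightarrow> 'a::topological_space) set \<Rightarrow> ((nat \<Rightarrow> 'a) \<Rightarrow> real) \<Rightarrow> (nat \<Rightarrow> 'a) measure \<Rightarrow> bool" where
  "equilibrium_state X \<phi> \<mu> \<longleftrightarrow> \<mu> \<in> invariant_measures X \<and>
     free_energy \<phi> \<mu> = (SUP \<nu>\<in>invariant_measures X. free_energy \<phi> \<nu>)"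

definition locally_constant_on ::
    "'x::topological_space set \<Rightarrow> ('x \<Rightarrow> 'b) \<Rightarrow> bool" where
  "locally_constant_on X \<phi> \<longleftrightarrow> locally (\<lambda>U. \<phi> constant_on U) X"

end

theory Submission
  imports Defs "HOL-Library.Sublist"
begin

text \<open>
  Choose \<open>N\<close> with \<open>n \<le> N ^ g n\<close> for large \<open>n\<close>, and let \<open>X\<close> consist of the binary sequences in which
  every run of \<open>k\<close> ones that is preceded by a zero is followed by at most \<open>N ^ k\<close> zeros. Overwriting
  the first \<open>g n\<close> letters of an \<open>n\<close>-letter word of the language by ones makes it possible to append
  it to every word, so the words that can be appended to every word approach the language.
  A run of zeros thus costs logarithmically many ones. With weight \<open>1 / (2 * N)\<close> per letter one,
  the partition sums over words of length \<open>n\<close> grow only linearly, so Gibbs' inequality gives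
  \<open>h(\<mu>) \<le> ln (2 * N) * \<mu>[1]\<close> for every invariant measure \<open>\<mu>\<close>. Charging slightly more than
  \<open>ln (2 * N)\<close> for the letter one leaves the point mass at \<open>000\<dots>\<close> as the only measure of free energy \<open>0\<close>.
\<close>

section \<open>A shift space with bounded runs of zeros\<close>

text \<open>The leading zero pins down the full length \<open>k\<close> of the run of ones. Without
  it a long run of ones would also be bound by the smaller limits attached to its shorter end
  pieces.\<close>

definition forbidden :: "nat \<Rightarrow> nat \<Rightarrow> nat list" where
  "forbidden N k = 0 # replicate k 1 @ replicate (Suc (N ^ k)) 0"

text \<open>Starting at \<open>k = 1\<close> leaves an initial block of zeros unrestricted, and a
  run of ones at the very beginning imposes no limit either, because no zero precedes it.\<close>

definition admissible :: "nat \<Rightarrow> nat list \<Rightarrow> bool" where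
  "admissible N w \<longleftrightarrow> set w \<subseteq> {0, 1} \<and> (\<forall>k\<ge>1. \<not> sublist (forbidden N k) w)"

definition run_shift :: "nat \<Rightarrow> (nat \<Rightarrow> nat) set" where
  "run_shift N = {x. \<forall>n. admissible N (map x [0..<n])}"

lemma admissible_sublist: "admissible N w \<Longrightarrow> sublist v w \<Longrightarrow> admissible N v"
  unfolding admissible_def
  by (meson set_mono_sublist sublist_order.order.trans subset_trans)

lemma admissible_Nil: "admissible N []"
  by (simp add: admissible_def forbidden_def)

lemma admissible_Cons: "admissible N (a # w) \<Longrightarrow> admissible N w"
  by (erule admissible_sublist) (simp add: sublist_Cons_right)

lemma last_forbidden: "last (forbidden N k) = 0"
  by (simp add: forbidden_def)

lemma forbidden_nth: "i < length (forbidden N k) \<Longrightarrow>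
    forbidden N k ! i = (if 1 \<le> i \<and> i \<le> k then 1 else 0)"
  by (auto simp: forbidden_def nth_Cons nth_append split: nat.split)

lemma length_forbidden: "length (forbidden N k) = k + N ^ k + 2"
  by (simp add: forbidden_def)

text \<open>A forbidden word inside \<open>u @ replicate K 1 @ w\<close> would have to start in
  \<open>u\<close> and end in \<open>w\<close>. It then contains the whole block of ones, so
  \<open>K \<le> k\<close>, and more than \<open>N ^ k \<ge> N ^ K\<close> letters of it must fit
  into \<open>w\<close>, which is too short.\<close>

lemma admissible_bridge:
  assumes u: "admissible N u" and w: "admissible N w"
    and K: "1 \<le> K" "length w \<le> N ^ K" and N: "2 \<le> N"
  shows "admissible N (u @ replicate K 1 @ w)"
proof -
  have "\<not> sublist (forbidden N k) (u @ replicate K 1 @ w)" if k: "1 \<le> k" for k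
  proof
    let ?f = "forbidden N k"
    \<comment> \<open>A forbidden word starts with a zero, so it cannot start inside the block of
      ones.\<close>
    have skip: "sublist ?f w" if "sublist ?f (replicate j 1 @ w)" for j
      using that
    proof (induction j)
      case (Suc j)
      have "\<not> prefix ?f (1 # replicate j 1 @ w)" by (simp add: forbidden_def)
      with Suc show ?case by (simp add: sublist_Cons_right)
    qed simp
    assume "sublist ?f (u @ replicate K 1 @ w)"
    moreover have "\<not> sublist ?f u" "\<not> sublist ?f w" using u w k by (auto simp: admissible_def)
    ultimately obtain p q where pq: "?f = p @ q" "suffix p u" "prefix q (replicate K 1 @ w)"
      unfolding sublist_append[of _ u] using skip by blast
    have "p \<noteq> []" using pq skip[of K] \<open>\<not> sublist ?f w\<close> by (auto dest: prefix_imp_sublist)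
    have "q \<noteq> []" using pq \<open>\<not> sublist ?f u\<close> by (auto dest: suffix_imp_sublist)
    \<comment> \<open>It ends with a zero as well, so it cannot end inside the block of
      ones.\<close>
    have "\<not> prefix q (replicate K 1)"
    proof
      assume "prefix q (replicate K 1)"
      then obtain r where "replicate K 1 = q @ r" by (auto simp: prefix_def)
      then have "last q \<in> set (replicate K 1)"
        using \<open>q \<noteq> []\<close> last_in_set[of q] by (simp only: set_append Un_iff simp_thms)
      then have "last q = 1" by simp
      moreover have "last q = 0" using last_forbidden[of N k] pq(1) \<open>q \<noteq> []\<close> by simp
      ultimately show False by simp
    qed
    then obtain z where z: "q = replicate K 1 @ z" "prefix z w"
      using pq(3) by (auto simp: prefix_append)
    have eq: "?f = p @ replicate K 1 @ z" using pq z by simp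
    \<comment> \<open>The position in the forbidden word of the last one of the block; since a one
      stands there, it is at most \<open>k\<close>.\<close>
    define i where "i = length p + K - 1"
    have i: "i < length ?f" using K by (simp add: eq i_def)
    have "?f ! i = 1" unfolding eq using K \<open>p \<noteq> []\<close>
      by (cases "length p") (auto simp: i_def nth_append not_less)
    then have "i \<le> k" using forbidden_nth[OF i] by (cases "i \<le> k") auto
    moreover have "length ?f = length p + K + length z" by (simp add: eq)
    moreover have "length p \<ge> 1" using \<open>p \<noteq> []\<close> by (simp add: Suc_le_eq)
    ultimately have "length z > N ^ k" "K \<le> k" using K
      unfolding length_forbidden i_def by linarith+
    moreover have "N ^ K \<le> N ^ k" using \<open>K \<le> k\<close> N by (intro power_increasing) auto
    moreover have "length z \<le> length w" using z(2) by (rule prefix_length_le)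
    ultimately show False using K by linarith
  qed
  then show ?thesis using u w by (auto simp: admissible_def)
qed

lemma language_run_shift:
  assumes N: "2 \<le> N"
  shows "language (run_shift N) = {w. admissible N w}"
proof (intro equalityI subsetI)
  fix w assume "w \<in> language (run_shift N)"
  then obtain x i j where x: "x \<in> run_shift N" and w: "w = map x [i..<j]"
    by (auto simp: language_def)
  have "w = drop i (map x [0..<j])" by (simp add: w drop_map)
  moreover have "admissible N (map x [0..<j])" using x by (simp add: run_shift_def)
  ultimately show "w \<in> {w. admissible N w}" using admissible_sublist sublist_drop by simp
next
  fix w assume "w \<in> {w. admissible N w}"
  then have w: "admissible N w" by simp
  \<comment> \<open>Padding with ones is safe: it is the bridge with an empty word on the right, for
    blocks of any length.\<close>
  define x where "x = (\<lambda>i. if i < length w then w ! i else 1)"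
  have long: "map x [0..<length w + j] = w @ replicate j 1" for j
    by (rule nth_equalityI) (auto simp: x_def nth_append)
  have "admissible N (w @ replicate j 1)" for j
    using admissible_bridge[OF w admissible_Nil, of "j", OF _ _ N] w by (cases "j = 0") auto
  moreover have "sublist (map x [0..<n]) (map x [0..<length w + n])" for n
  proof -
    have "take n (map x [0..<length w + n]) = map x [0..<n]"
      by (simp only: take_map take_upt add_0 le_add2)
    then show ?thesis using sublist_take[of n "map x [0..<length w + n]"] by (simp only:)
  qed
  ultimately have "admissible N (map x [0..<n])" for n
    using admissible_sublist[of N "map x [0..<length w + n]"] by (simp only: long)
  then have "x \<in> run_shift N" by (simp add: run_shift_def)
  moreover have "w = map x [0..<length w]" using long[of 0] by simp
  ultimately show "w \<in> language (run_shift N)" unfolding language_def by blast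
qed

section \<open>Sets determined by finitely many coordinates\<close>

text \<open>These are the unions of cylinders over the first \<open>n\<close> coordinates. The
  condition on \<open>x\<close> and \<open>y\<close> is symmetric, so one implication
  suffices.\<close>

definition determined :: "nat \<Rightarrow> (nat \<Rightarrow> 'a) set \<Rightarrow> bool" where
  "determined n B \<longleftrightarrow> (\<forall>x y. (\<forall>i<n. x i = y i) \<longrightarrow> x \<in> B \<longrightarrow> y \<in> B)"

lemma determinedI:
  "(\<And>x y. x \<in> B \<Longrightarrow> (\<And>i. i < n \<Longrightarrow> x i = y i) \<Longrightarrow> y \<in> B) \<Longrightarrow> determined n B"
  unfolding determined_def by simp

lemma determinedD:
  "determined n B \<Longrightarrow> x \<in> B \<Longrightarrow> (\<And>i. i < n \<Longrightarrow> x i = y i) \<Longrightarrow> y \<in> B"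
  unfolding determined_def by blast

lemma open_determined:
  fixes B :: "(nat \<Rightarrow> 'a::discrete_topology) set"
  assumes "determined n B"
  shows "open B"
proof (subst open_subopen, intro ballI)
  fix x assume x: "x \<in> B"
  define U where "U = (\<Inter>i<n. (\<lambda>y. y i) -` {x i})"
  have "open {a}" for a :: 'a by (meson at_discrete at_eq_bot_iff)
  then have "open U" unfolding U_def
    by (intro open_INT ballI open_vimage continuous_on_product_coordinates) auto
  moreover have "x \<in> U" by (auto simp: U_def)
  moreover have "U \<subseteq> B" using determinedD[OF assms x] by (auto simp: U_def)
  ultimately show "\<exists>T. open T \<and> x \<in> T \<and> T \<subseteq> B" by blast
qed

lemma determined_Compl: "determined n B \<Longrightarrow> determined n (- B)"
  unfolding determined_def
proof (intro allI impI)
  fix x y :: "nat \<Rightarrow> 'a"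
  assume B: "\<forall>x y. (\<forall>i<n. x i = y i) \<longrightarrow> x \<in> B \<longrightarrow> y \<in> B"
    and xy: "\<forall>i<n. x i = y i" and x: "x \<in> - B"
  from B[rule_format, of y x] xy x show "y \<in> - B" by auto
qed

lemma determined_words: "determined n {x. P (map x [0..<n])}"
  unfolding determined_def mem_Collect_eq
proof (intro allI impI)
  fix x y :: "nat \<Rightarrow> 'a"
  assume xy: "\<forall>i<n. x i = y i" and P: "P (map x [0..<n])"
  have "map y [0..<n] = map x [0..<n]" using xy by simp
  then show "P (map y [0..<n])" using P by (simp only:)
qed

lemma shift_space_run_shift: "shift_space {0, 1} (run_shift N)"
  unfolding shift_space_def
proof (intro conjI)
  show "run_shift N \<subseteq> UNIV \<rightarrow> {0, 1}"
  proof (intro subsetI Pi_I)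
    fix x i assume "x \<in> run_shift N"
    then have "admissible N (map x [0..<Suc i])" unfolding run_shift_def by blast
    then show "x i \<in> {0, 1}" by (auto simp: admissible_def)
  qed
  \<comment> \<open>Each set in the intersection depends on \<open>n\<close> coordinates only, hence
    is closed as well as open.\<close>
  have "run_shift N = (\<Inter>n. {x. admissible N (map x [0..<n])})"
    by (auto simp: run_shift_def)
  moreover have "closed {x. admissible N (map x [0..<n])}" for n
    unfolding closed_def by (rule open_determined[OF determined_Compl[OF determined_words]])
  ultimately show "closed (run_shift N)" by auto
  have "admissible N (map (shift x) [0..<n])" if "x \<in> run_shift N" for x n
  proof -
    have "map x [0..<Suc n] = x 0 # map (shift x) [0..<n]"
      by (simp add: map_upt_Suc shift_def del: upt_Suc)
    then show ?thesis using that admissible_Cons unfolding run_shift_def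
      by (metis (mono_tags, lifting) mem_Collect_eq)
  qed
  then show "shift ` run_shift N \<subseteq> run_shift N" by (auto simp: run_shift_def)
qed simp

section \<open>Words that may follow every admissible word\<close>

text \<open>This is the collection \<open>G\<close> of the theorem. Quantifying over all left
  contexts \<open>u\<close> makes it closed under concatenation, and the empty context shows that
  its words are admissible.\<close>

definition free_words :: "nat \<Rightarrow> nat list set" where
  "free_words N = {w. \<forall>u. admissible N u \<longrightarrow> admissible N (u @ w)}"

lemma free_wordsI: "(\<And>u. admissible N u \<Longrightarrow> admissible N (u @ w)) \<Longrightarrow> w \<in> free_words N"
  by (simp add: free_words_def)

lemma free_wordsD: "w \<in> free_words N \<Longrightarrow> admissible N u \<Longrightarrow> admissible N (u @ w)"
  by (simp add: free_words_def)

lemma free_words_subset: "w \<in> free_words N \<Longrightarrow> admissible N w"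
  using free_wordsD[OF _ admissible_Nil] by simp

lemma concatenations_free_words: "concatenations (free_words N) \<subseteq> free_words N"
proof -
  have "concat ws \<in> free_words N" if "ws \<in> lists (free_words N)" for ws
    using that
  proof induction
    case (Cons w ws)
    then have w: "w \<in> free_words N" and ws: "concat ws \<in> free_words N" by auto
    show ?case
    proof (rule free_wordsI)
      fix u assume "admissible N u"
      from free_wordsD[OF ws free_wordsD[OF w this]] show "admissible N (u @ concat (w # ws))" by simp
    qed
  qed (simp add: free_words_def)
  then show ?thesis by (auto simp: concatenations_def)
qed

lemma hamming_approachable_free_words:
  assumes N: "2 \<le> N" and g: "\<And>n. 1 \<le> n \<Longrightarrow> 1 \<le> g n"
    and ev: "eventually (\<lambda>n. n \<le> N ^ g n) sequentially"
  shows "hamming_approachable g {w. admissible N w} (free_words N)"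
  unfolding hamming_approachable_def
proof (intro conjI)
  show "free_words N \<subseteq> {w. admissible N w}" using free_words_subset by auto
  obtain m where m: "\<And>n. m \<le> n \<Longrightarrow> n \<le> N ^ g n"
    using ev by (auto simp: eventually_sequentially)
  have "\<exists>v\<in>words_of_length (free_words N) n. hamming_dist v w \<le> g n"
    if n: "max 1 m \<le> n" and w: "w \<in> words_of_length {w. admissible N w} n" for n w
  proof -
    \<comment> \<open>The minimum covers \<open>g n > n\<close>, where the whole word is
      overwritten; \<open>n \<le> N ^ n\<close> then supplies the length condition of the
      bridge.\<close>
    define K where "K = min (g n) n"
    have "n < 2 ^ n" by (rule less_exp)
    also have "2 ^ n \<le> N ^ n" using N by (rule power_mono) simp
    finally have "n \<le> N ^ K" using m[of n] n by (simp add: K_def min_def)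
    have len: "length w = n" and adm: "admissible N w" using w by (auto simp: words_of_length_def)
    have "1 \<le> K" using g[of n] n by (simp add: K_def)
    define v where "v = replicate K 1 @ drop K w"
    have "admissible N (drop K w)" using admissible_sublist[OF adm] by blast
    then have "v \<in> free_words N"
      unfolding free_words_def v_def using admissible_bridge[OF _ _ \<open>1 \<le> K\<close> _ N] \<open>n \<le> N ^ K\<close> len by simp
    moreover have "length v = n" by (simp add: v_def len K_def)
    moreover have "hamming_dist v w \<le> g n"
    proof -
      have "{i. i < length w \<and> v ! i \<noteq> w ! i} \<subseteq> {..<K}"
        by (auto simp: v_def nth_append len K_def not_less split: if_splits)
      then have "hamming_dist v w \<le> card {..<K}" unfolding hamming_dist_def by (intro card_mono) auto
      then show ?thesis by (simp add: K_def)
    qed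
    ultimately show ?thesis unfolding words_of_length_def by blast
  qed
  then show "\<exists>n0\<ge>1. \<forall>n\<ge>n0. \<forall>w\<in>words_of_length {w. admissible N w} n.
      \<exists>v\<in>words_of_length (free_words N) n. hamming_dist v w \<le> g n"
    by (intro exI[of _ "max 1 m"]) auto
qed

text \<open>If \<open>g n > c * ln n\<close> and \<open>exp (1 / c) \<le> N\<close>, then
  \<open>n = exp (ln n) \<le> exp (g n / c) \<le> N ^ g n\<close>.\<close>

lemma exponential_dominates:
  fixes g :: "nat \<Rightarrow> nat"
  assumes "Liminf sequentially (\<lambda>n. ereal (real (g n) / ln (real n))) > 0"
  obtains N where "2 \<le> N" "eventually (\<lambda>n. n \<le> N ^ g n) sequentially"
proof -
  obtain c where c: "0 < c" "ereal c < Liminf sequentially (\<lambda>n. ereal (real (g n) / ln (real n)))"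
    using ereal_dense2[OF assms] by auto
  have y: "eventually (\<lambda>n. ereal c < ereal (real (g n) / ln (real n))) sequentially"
    using c(2) by (rule less_LiminfD)
  define N where "N = max 2 (nat \<lceil>exp (1 / c)\<rceil>)"
  have N: "exp (1 / c) \<le> real N" by (simp add: N_def) linarith
  have "n \<le> N ^ g n" if "ereal c < ereal (real (g n) / ln (real n))" "2 \<le> n" for n
  proof -
    have "c < real (g n) / ln (real n)" using that by simp
    then have "ln (real n) \<le> 1 / c * real (g n)" using that c by (simp add: field_simps)
    then have "exp (ln (real n)) \<le> exp (1 / c * real (g n))" by (simp only: exp_le_cancel_iff)
    then have "real n \<le> exp (1 / c * real (g n))" using that by simp
    also have "\<dots> = exp (1 / c) ^ g n" using exp_of_nat_mult[of "g n" "1 / c"] by (simp add: mult.commute)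
    also have "\<dots> \<le> real N ^ g n" using N by (intro power_mono) auto
    finally show ?thesis by (simp flip: of_nat_power)
  qed
  then have "eventually (\<lambda>n. n \<le> N ^ g n) sequentially"
    using eventually_conj[OF y eventually_ge_at_top[of 2]] by (auto elim: eventually_mono)
  then show thesis by (intro that[of N]) (auto simp: N_def)
qed


section \<open>Word counts and partition sums\<close>

text \<open>Fekete's lemma. It serves both the word counts and the entropies of itineraries, whose
  definitions use \<open>lim\<close> and are informative only once convergence is known.\<close>

lemma fekete_convergent:
  fixes u :: "nat \<Rightarrow> real"
  assumes nonneg: "\<And>n. 0 \<le> u n" and sub: "\<And>m n. u (m + n) \<le> u m + u n"
  shows "convergent (\<lambda>n. u n / real n)"
proof -
  \<comment> \<open>Index 0 is left out because \<open>u 0 / 0 = 0\<close> would pull the infimum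
    down to 0.\<close>
  define L where "L = (INF n\<in>{1..}. u n / real n)"
  have bdd: "bdd_below ((\<lambda>n. u n / real n) ` {1..})"
    using nonneg by (intro bdd_belowI[of _ 0]) auto
  have lower: "L \<le> u n / real n" if "1 \<le> n" for n
    unfolding L_def using that by (intro cINF_lower[OF bdd]) auto
  have mult: "u (q * m) \<le> real q * u m + u 0" for q m
  proof (induction q)
    case (Suc q)
    then show ?case using sub[of m "q * m"] by (simp add: algebra_simps)
  qed simp
  have "(\<lambda>n. u n / real n) \<longlonglongrightarrow> L"
  proof (rule LIMSEQ_I)
    fix e :: real assume e: "0 < e"
    have "(INF n\<in>{1..}. u n / real n) < L + e / 2" using e unfolding L_def by linarith
    then have "\<exists>m\<in>{1..}. u m / real m < L + e / 2" by (subst (asm) cINF_less_iff[OF _ bdd]) auto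
    then obtain m where m: "1 \<le> m" "u m / real m < L + e / 2" by auto
    \<comment> \<open>A bound, independent of \<open>n\<close>, for the cost of the remainder
      \<open>n mod m\<close> plus the term \<open>u 0\<close> from \<open>mult\<close>.\<close>
    define C where "C = u 0 + (\<Sum>i<m. u i)"
    obtain n0 where n0: "2 * C / e < real n0" using reals_Archimedean2 by blast
    have "norm (u n / real n - L) < e" if n: "max 1 n0 \<le> n" for n
    proof -
      have "u (n mod m) \<le> (\<Sum>i<m. u i)"
        using m nonneg by (intro member_le_sum) auto
      then have "u n \<le> real (n div m) * u m + C"
        using sub[of "n div m * m" "n mod m"] mult[of "n div m" m] by (simp add: C_def)
      also have "real (n div m) * u m = real (n div m * m) * (u m / real m)"
        using m by simp
      also have "\<dots> \<le> real n * (u m / real m)"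
        using nonneg[of m] by (intro mult_right_mono) (auto simp: div_times_less_eq_dividend simp del: of_nat_mult)
      finally have "u n / real n \<le> u m / real m + C / real n"
        using n by (simp add: field_simps)
      moreover have "C / real n < e / 2"
      proof -
        have "2 * C / e < real n" using n0 n by simp
        then show ?thesis using e n by (simp add: field_simps)
      qed
      ultimately show ?thesis using m lower[of n] n unfolding real_norm_def by linarith
    qed
    then show "\<exists>no. \<forall>n\<ge>no. norm (u n / real n - L) < e" by blast
  qed
  then show ?thesis by (rule convergentI)
qed

section \<open>Positive topological entropy\<close>

definition admissible_words :: "nat \<Rightarrow> nat \<Rightarrow> nat list set" where
  "admissible_words N n = {w. admissible N w \<and> length w = n}"

lemma finite_admissible_words: "finite (admissible_words N n)"
  by (rule finite_subset[OF _ finite_lists_length_eq[of "{0, 1}" n]])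
     (auto simp: admissible_words_def admissible_def)

lemma card_admissible_words_add:
  "card (admissible_words N (m + n)) \<le> card (admissible_words N m) * card (admissible_words N n)"
proof -
  have "card (admissible_words N (m + n)) \<le> card (admissible_words N m \<times> admissible_words N n)"
  proof (rule card_inj_on_le)
    show "inj_on (\<lambda>w. (take m w, drop m w)) (admissible_words N (m + n))"
      by (intro inj_onI) (metis append_take_drop_id prod.inject)
    show "(\<lambda>w. (take m w, drop m w)) ` admissible_words N (m + n) \<subseteq>
        admissible_words N m \<times> admissible_words N n"
      by (auto simp: admissible_words_def intro: admissible_sublist)
  qed (auto intro: finite_admissible_words)
  then show ?thesis by (simp add: card_cartesian_product)
qed

text \<open>After any admissible word a single one may be written and then an arbitrary letter: this
  is the bridge with \<open>K = 1\<close>, as one letter is at most \<open>N\<close> letters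
  long.\<close>

lemma card_admissible_words_double:
  assumes N: "2 \<le> N"
  shows "2 * card (admissible_words N n) \<le> card (admissible_words N (n + 2))"
proof -
  have single: "admissible N [a]" if "a \<in> {0, 1}" for a
    using that length_forbidden[of N] by (auto simp: admissible_def dest: sublist_length_le)
  have "card (admissible_words N n \<times> {0, 1::nat}) \<le> card (admissible_words N (n + 2))"
  proof (rule card_inj_on_le)
    show "inj_on (\<lambda>(w, a). w @ [1, a]) (admissible_words N n \<times> {0, 1})"
      by (intro inj_onI) auto
    show "(\<lambda>(w, a). w @ [1, a]) ` (admissible_words N n \<times> {0, 1}) \<subseteq> admissible_words N (n + 2)"
      using admissible_bridge[of N _ "[_]" 1, OF _ single] N by (auto simp: admissible_words_def)
  qed (rule finite_admissible_words)
  then show ?thesis by (simp add: card_cartesian_product)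
qed

text \<open>The limit exists by Fekete's lemma, so it may be bounded along even lengths, where
  repeated doubling gives at least \<open>ln 2 / 2\<close>.\<close>

lemma topological_entropy_run_shift:
  assumes N: "2 \<le> N"
  shows "0 < topological_entropy (run_shift N)"
proof -
  define u where "u n = ln (real (card (admissible_words N n)))" for n
  have "words_of_length (language (run_shift N)) n = admissible_words N n" for n
    by (auto simp: language_run_shift[OF N] words_of_length_def admissible_words_def)
  then have eq: "topological_entropy (run_shift N) = lim (\<lambda>n. u n / real n)"
    by (simp add: topological_entropy_def u_def)
  \<comment> \<open>Words of ones keep every count positive, so that the logarithms are nonnegative
    and subadditive.\<close>
  have "replicate n 1 \<in> admissible_words N n" for n
    using admissible_bridge[OF admissible_Nil admissible_Nil, of n N] N admissible_Nil
    by (cases "n = 0") (auto simp: admissible_words_def)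
  then have pos: "1 \<le> card (admissible_words N n)" for n
    using finite_admissible_words[of N n] by (metis One_nat_def Suc_leI card_gt_0_iff empty_iff)
  have "u (m + n) \<le> u m + u n" for m n
  proof -
    have "u (m + n) \<le> ln (real (card (admissible_words N m) * card (admissible_words N n)))"
      unfolding u_def using card_admissible_words_add[of N m n] pos[of "m + n"] by (intro ln_mono; linarith)
    also have "\<dots> = u m + u n" using pos[of m] pos[of n] by (simp add: u_def ln_mult)
    finally show ?thesis .
  qed
  moreover have "0 \<le> u n" for n using pos[of n] by (simp add: u_def)
  ultimately obtain L where L: "(\<lambda>n. u n / real n) \<longlonglongrightarrow> L"
    using fekete_convergent[of u] by (auto simp: convergent_def)
  have "2 ^ n \<le> card (admissible_words N (2 * n))" for n
  proof (induction n)
    case (Suc n)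
    then show ?case using card_admissible_words_double[OF N, of "2 * n"] by simp
  qed (use pos[of 0] in simp)
  then have "real (2 ^ n) \<le> real (card (admissible_words N (2 * n)))" for n by (simp only: of_nat_le_iff)
  then have "ln (2 ^ n) \<le> u (2 * n)" for n
    unfolding u_def by (intro ln_mono) (auto simp: order_trans)
  then have "ln 2 / 2 \<le> u (2 * n) / real (2 * n)" if "1 \<le> n" for n
    using that by (simp add: ln_realpow field_simps)
  moreover have "(\<lambda>n. u (2 * n) / real (2 * n)) \<longlonglongrightarrow> L"
    using LIMSEQ_subseq_LIMSEQ[OF L, of "\<lambda>n. 2 * n"] by (simp add: strict_mono_def o_def)
  ultimately have "ln 2 / 2 \<le> L"
    using LIMSEQ_le_const[of _ L "ln 2 / 2"] by blast
  moreover have "0 < ln (2::real)" by simp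
  ultimately show ?thesis unfolding eq limI[OF L] by linarith
qed

section \<open>Weighted word counts\<close>

text \<open>The partition function over \<open>W\<close> when each letter one has energy
  \<open>ln s\<close> and each zero has energy 0.\<close>

definition weight_sum :: "real \<Rightarrow> nat list set \<Rightarrow> real" where
  "weight_sum s W = (\<Sum>w\<in>W. s ^ count_list w 1)"

lemma weight_sum_mono:
  "0 \<le> s \<Longrightarrow> finite V \<Longrightarrow> W \<subseteq> V \<Longrightarrow> weight_sum s W \<le> weight_sum s V"
  unfolding weight_sum_def by (intro sum_mono2) auto

lemma weight_sum_Cons:
  assumes s: "0 \<le> s" and W: "W \<subseteq> (#) 1 ` U \<union> (#) 0 ` V" and fin: "finite U" "finite V"
  shows "weight_sum s W \<le> s * weight_sum s U + weight_sum s V"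
proof -
  have "weight_sum s W \<le> weight_sum s ((#) 1 ` U \<union> (#) 0 ` V)"
    using W fin s by (intro weight_sum_mono) auto
  also have "\<dots> = weight_sum s ((#) 1 ` U) + weight_sum s ((#) 0 ` V)"
    unfolding weight_sum_def using fin by (intro sum.union_disjoint) auto
  also have "\<dots> = s * weight_sum s U + weight_sum s V"
    by (simp add: weight_sum_def sum.reindex sum_distrib_left)
  finally show ?thesis .
qed

text \<open>
  The recursions below only count upper bounds: admissibility of the prefixed words passes to
  factors, so after a new letter one only the run of ones has to be remembered.
\<close>

definition after_ones :: "nat \<Rightarrow> nat \<Rightarrow> nat \<Rightarrow> nat list set" where
  "after_ones N k n = {w. length w = n \<and> admissible N (0 # replicate k 1 @ w)}"

definition after_zeros :: "nat \<Rightarrow> nat \<Rightarrow> nat \<Rightarrow> nat \<Rightarrow> nat list set" where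
  "after_zeros N k j n = {w. length w = n \<and> admissible N (0 # replicate k 1 @ replicate j 0 @ w)}"

lemma after_subset:
  "after_ones N k n \<subseteq> admissible_words N n" "after_zeros N k j n \<subseteq> admissible_words N n"
  unfolding after_ones_def after_zeros_def admissible_words_def
  by (auto elim!: admissible_sublist) (metis append_Cons append_assoc sublist_append_leftI)+

lemmas finite_after = finite_subset[OF after_subset(1) finite_admissible_words]
  finite_subset[OF after_subset(2) finite_admissible_words]

lemma after_ones_Suc:
  "after_ones N k (Suc n) \<subseteq> (#) 1 ` after_ones N (Suc k) n \<union> (#) 0 ` after_zeros N k 1 n"
proof
  fix w assume w: "w \<in> after_ones N k (Suc n)"
  then obtain a v where v: "w = a # v" by (cases w) (auto simp: after_ones_def)
  then have "a \<in> {0, 1}" using w by (auto simp: after_ones_def admissible_def)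
  then show "w \<in> (#) 1 ` after_ones N (Suc k) n \<union> (#) 0 ` after_zeros N k 1 n"
    using w v by (auto simp: after_ones_def after_zeros_def replicate_app_Cons_same)
qed

lemma after_zeros_Suc:
  assumes "1 \<le> j"
  shows "after_zeros N k j (Suc n) \<subseteq> (#) 1 ` after_ones N 1 n \<union> (#) 0 ` after_zeros N k (Suc j) n"
proof
  fix w assume w: "w \<in> after_zeros N k j (Suc n)"
  then obtain a v where v: "w = a # v" by (cases w) (auto simp: after_zeros_def)
  then have a: "a \<in> {0, 1}" using w by (auto simp: after_zeros_def admissible_def)
  have adm: "admissible N (0 # replicate k 1 @ replicate j 0 @ a # v)"
    using w v by (simp add: after_zeros_def)
  have len: "length v = n" using w v by (simp add: after_zeros_def)
  show "w \<in> (#) 1 ` after_ones N 1 n \<union> (#) 0 ` after_zeros N k (Suc j) n"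
  proof (cases "a = 0")
    case True
    then show ?thesis using adm len v by (auto simp: after_zeros_def replicate_app_Cons_same)
  next
    case False
    \<comment> \<open>The last of the \<open>j\<close> zeros is split off to serve as the zero in
      front of the new run of ones.\<close>
    obtain i where "j = Suc i" using assms by (cases j) auto
    then have "0 # replicate k 1 @ replicate j 0 @ a # v = (0 # replicate k 1 @ replicate i 0) @ (0 # a # v)"
      by (simp add: replicate_app_Cons_same)
    then have "admissible N (0 # a # v)"
      using adm admissible_sublist sublist_append_leftI by metis
    then show ?thesis using False a len v by (auto simp: after_ones_def)
  qed
qed

lemma after_zeros_empty:
  assumes "1 \<le> k" "N ^ k < j"
  shows "after_zeros N k j n = {}"
proof -
  have "\<not> admissible N (0 # replicate k 1 @ replicate j 0 @ w)" for w
  proof -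
    obtain i where "j = Suc (N ^ k) + i" using assms(2) by (metis Suc_leI le_Suc_ex)
    then have "0 # replicate k 1 @ replicate j 0 @ w = forbidden N k @ replicate i 0 @ w"
      by (simp add: forbidden_def replicate_add)
    then show ?thesis using assms(1) by (metis admissible_def sublist_append_rightI)
  qed
  then show ?thesis by (simp add: after_zeros_def)
qed

text \<open>The bounds solve the two recursions with equality, since
  \<open>s * (2 * N ^ Suc k) = N ^ k\<close> and \<open>s * (2 * N) = 1\<close>. Each further zero
  lowers the second bound by one, until it vanishes at \<open>j = Suc (N ^ k)\<close>, where no word
  is left.\<close>

lemma weight_sum_after:
  assumes N: "2 \<le> N"
  defines "s \<equiv> 1 / (2 * real N)"
  shows "\<And>k. 1 \<le> k \<Longrightarrow> weight_sum s (after_ones N k n) \<le> 2 * real N ^ k"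
    and "\<And>k j. 1 \<le> k \<Longrightarrow> 1 \<le> j \<Longrightarrow> j \<le> Suc (N ^ k) \<Longrightarrow>
      weight_sum s (after_zeros N k j n) \<le> real N ^ k + 1 - real j"
proof (induction n)
  case 0
  have s: "0 \<le> s" by (simp add: s_def)
  have le: "weight_sum s W \<le> 1" if "W \<subseteq> {[]}" for W
    using weight_sum_mono[OF s _ that] by (simp add: weight_sum_def)
  {
    case (1 k)
    have "1 \<le> real N ^ k" using N by (intro one_le_power) simp
    then show ?case using le[of "after_ones N k 0"] by (force simp: after_ones_def)
  next
    case (2 k j)
    show ?case
    proof (cases "j \<le> N ^ k")
      case True
      then have "real j \<le> real N ^ k" by (simp flip: of_nat_power)
      moreover have "weight_sum s (after_zeros N k j 0) \<le> 1" by (rule le) (auto simp: after_zeros_def)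
      ultimately show ?thesis by linarith
    next
      case False
      then have "j = Suc (N ^ k)" using 2 by simp
      then show ?thesis using after_zeros_empty[of k N j] 2 by (simp add: weight_sum_def)
    qed
  }
next
  case (Suc n)
  have s: "0 \<le> s" by (simp add: s_def)
  {
    case (1 k)
    have "weight_sum s (after_ones N k (Suc n))
        \<le> s * weight_sum s (after_ones N (Suc k) n) + weight_sum s (after_zeros N k 1 n)"
      using finite_after by (intro weight_sum_Cons[OF s after_ones_Suc])
    also have "\<dots> \<le> s * (2 * real N ^ Suc k) + (real N ^ k + 1 - real 1)"
      using 1 s by (intro add_mono mult_left_mono Suc.IH) auto
    also have "\<dots> = 2 * real N ^ k" using N by (simp add: s_def field_simps)
    finally show ?case .
  next
    case (2 k j)
    show ?case
    proof (cases "j \<le> N ^ k")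
      case True
      have "weight_sum s (after_zeros N k j (Suc n))
          \<le> s * weight_sum s (after_ones N 1 n) + weight_sum s (after_zeros N k (Suc j) n)"
        using finite_after 2 by (intro weight_sum_Cons[OF s after_zeros_Suc])
      also have "\<dots> \<le> s * (2 * real N ^ 1) + (real N ^ k + 1 - real (Suc j))"
        using 2 s True by (intro add_mono mult_left_mono Suc.IH) auto
      also have "\<dots> = real N ^ k + 1 - real j" using N by (simp add: s_def field_simps)
      finally show ?thesis .
    next
      case False
      then have "j = Suc (N ^ k)" using 2 by simp
      then show ?thesis using after_zeros_empty[of k N j] 2 by (simp add: weight_sum_def)
    qed
  }
qed

text \<open>A long run of ones can precede every word, which absorbs the unbounded initial run of zeros.\<close>

lemma weight_sum_admissible_words:
  assumes N: "2 \<le> N" and n: "1 \<le> n"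
  shows "weight_sum (1 / (2 * real N)) (admissible_words N n) \<le> 2 * real N * real n"
proof -
  \<comment> \<open>\<open>K\<close> is the integer part of the logarithm of \<open>n\<close> to
    base \<open>N\<close>: the upper estimate allows a bridge of \<open>K + 1\<close> ones, the
    lower one turns the resulting \<open>2 * N ^ (K + 1)\<close> into a linear bound.\<close>
  obtain K where K: "N ^ K \<le> n" "n < N ^ (K + 1)" using ex_power_ivl1[OF N n] by blast
  have zero: "admissible N [0]"
    using length_forbidden[of N] by (auto simp: admissible_def dest: sublist_length_le)
  have "admissible_words N n \<subseteq> after_ones N (K + 1) n"
    using admissible_bridge[OF zero _ _ _ N, of _ "K + 1"] K by (auto simp: admissible_words_def after_ones_def)
  then have "weight_sum (1 / (2 * real N)) (admissible_words N n) \<le>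
      weight_sum (1 / (2 * real N)) (after_ones N (K + 1) n)"
    using finite_after by (intro weight_sum_mono) auto
  also have "\<dots> \<le> 2 * real N ^ (K + 1)" by (rule weight_sum_after[OF N]) simp
  also have "\<dots> = 2 * real N * real (N ^ K)" by simp
  also have "\<dots> \<le> 2 * real N * real n" using K by (intro mult_left_mono) (auto simp del: of_nat_power)
  finally show ?thesis .
qed


section \<open>Approximation of finite partitions by cylinders\<close>

text \<open>\<open>B\<close> and \<open>D\<close> are sets of arbitrary sequences while
  \<open>M\<close> lives on a subspace, hence the intersection with \<open>space M\<close>.\<close>

definition cylinder_approximable :: "(nat \<Rightarrow> 'a) measure \<Rightarrow> (nat \<Rightarrow> 'a) set \<Rightarrow> bool" where
  "cylinder_approximable M B \<longleftrightarrow>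
     (\<forall>e>0. \<exists>n D. determined n D \<and> measure M (sym_diff B D \<inter> space M) < e)"

lemma determined_mono: "determined m D \<Longrightarrow> m \<le> n \<Longrightarrow> determined n D"
  by (rule determinedI) (auto elim: determinedD)

lemma determined_Un: "determined n C \<Longrightarrow> determined n D \<Longrightarrow> determined n (C \<union> D)"
  by (rule determinedI) (auto dest: determinedD)

lemma determined_approximable: "determined n D \<Longrightarrow> cylinder_approximable M D"
  unfolding cylinder_approximable_def by (intro allI impI exI[of _ n] exI[of _ D]) simp

lemma open_UN_determined:
  fixes U :: "(nat \<Rightarrow> 'a::discrete_topology) set"
  assumes "open U"
  obtains D where "\<And>n. determined n (D n)" "U = (\<Union>n. D n)"
proof -
  \<comment> \<open>The points whose cylinder of length \<open>n\<close> lies entirely in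
    \<open>U\<close>.\<close>
  define D where "D n = {x. \<forall>y. (\<forall>i<n. y i = x i) \<longrightarrow> y \<in> U}" for n
  have "determined n (D n)" for n
    unfolding determined_def D_def by simp
  moreover have "D n \<subseteq> U" for n by (auto simp: D_def)
  moreover have "\<exists>n. x \<in> D n" if x: "x \<in> U" for x
  proof -
    from assms have "openin (product_topology (\<lambda>i. euclidean) UNIV) U"
      by (simp add: open_fun_def)
    from product_topology_open_contains_basis[OF this x]
    obtain B where B: "x \<in> (\<Pi>\<^sub>E i\<in>UNIV. B i)" "finite {i. B i \<noteq> UNIV}" "(\<Pi>\<^sub>E i\<in>UNIV. B i) \<subseteq> U"
      by auto
    obtain n where n: "{i. B i \<noteq> UNIV} \<subseteq> {..<n}"
      using B(2) finite_nat_iff_bounded by blast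
    have "y \<in> U" if "\<forall>i<n. y i = x i" for y
    proof -
      have "y i \<in> B i" for i
        using that n B(1) by (cases "i < n") (auto simp: PiE_iff)
      then show ?thesis using B(3) by auto
    qed
    then show ?thesis by (auto simp: D_def)
  qed
  ultimately show thesis by (intro that[of D]) auto
qed

lemma determined_borel: "determined n (D :: (nat \<Rightarrow> 'a::discrete_topology) set) \<Longrightarrow> D \<in> sets borel"
  by (simp add: open_determined borel_open)

context
  fixes M :: "(nat \<Rightarrow> 'a::discrete_topology) measure" and X
  assumes M: "finite_measure M" and sets_M: "sets M = sets (restrict_space borel X)"
begin

interpretation finite_measure M by (rule M)

lemma space_restrict: "space M = X"
  using sets_eq_imp_space_eq[OF sets_M] by (simp add: space_restrict_space)

lemma borel_Int_space: "B \<in> sets borel \<Longrightarrow> B \<inter> space M \<in> sets M"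
  by (auto simp: sets_M sets_restrict_space space_restrict)

lemma approximable_Un:
  assumes B: "B \<in> sets borel" "cylinder_approximable M B"
    and C: "C \<in> sets borel" "cylinder_approximable M C"
  shows "cylinder_approximable M (B \<union> C)"
  unfolding cylinder_approximable_def
proof (intro allI impI)
  fix e :: real assume "0 < e"
  then have e: "0 < e / 2" by simp
  obtain m D where D: "determined m D" "measure M (sym_diff B D \<inter> space M) < e / 2"
    using B(2) e unfolding cylinder_approximable_def by meson
  obtain n E where E: "determined n E" "measure M (sym_diff C E \<inter> space M) < e / 2"
    using C(2) e unfolding cylinder_approximable_def by meson
  note [simp] = determined_borel[OF D(1)] determined_borel[OF E(1)] B(1) C(1)
  have "measure M (sym_diff (B \<union> C) (D \<union> E) \<inter> space M)
      \<le> measure M ((sym_diff B D \<inter> space M) \<union> (sym_diff C E \<inter> space M))"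
    by (intro finite_measure_mono sets.Un borel_Int_space) auto
  also have "\<dots> \<le> measure M (sym_diff B D \<inter> space M) + measure M (sym_diff C E \<inter> space M)"
    by (intro measure_Un_le borel_Int_space sets.Un sets.Diff) auto
  finally have "measure M (sym_diff (B \<union> C) (D \<union> E) \<inter> space M) < e" using D E by simp
  moreover have "determined (max m n) (D \<union> E)"
    using D E by (intro determined_Un) (auto intro: determined_mono)
  ultimately show "\<exists>n D. determined n D \<and> measure M (sym_diff (B \<union> C) D \<inter> space M) < e" by blast
qed

text \<open>Continuity from below replaces the union by a finite one at the cost of
  \<open>e / 2\<close>; the other half pays for approximating the finite union.\<close>

lemma approximable_UN:
  fixes B :: "nat \<Rightarrow> (nat \<Rightarrow> 'a) set"
  assumes B: "\<And>i. B i \<in> sets borel" "\<And>i. cylinder_approximable M (B i)"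
  shows "cylinder_approximable M (\<Union>i. B i)"
  unfolding cylinder_approximable_def
proof (intro allI impI)
  fix e :: real assume "0 < e"
  then have e: "0 < e / 2" by simp
  define C where "C n = (\<Union>i<n. B i)" for n
  have C: "C n \<in> sets borel" for n unfolding C_def using B(1) by auto
  have "cylinder_approximable M (C n)" for n
  proof (induction n)
    case 0
    show ?case unfolding C_def by (rule determined_approximable[of 0]) (simp add: determined_def)
  next
    case (Suc n)
    have "C (Suc n) = C n \<union> B n" by (auto simp: C_def less_Suc_eq)
    then show ?case using approximable_Un[OF C Suc B] by simp
  qed
  moreover have "incseq (\<lambda>n. C n \<inter> space M)" by (force simp: C_def incseq_def)
  then have "(\<lambda>n. measure M (C n \<inter> space M)) \<longlonglongrightarrow> measure M (\<Union>n. C n \<inter> space M)"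
    using borel_Int_space[OF C] by (intro finite_Lim_measure_incseq) auto
  moreover have UN: "(\<Union>n. C n \<inter> space M) = (\<Union>i. B i) \<inter> space M" by (auto simp: C_def)
  ultimately obtain n where n: "\<bar>measure M (C n \<inter> space M) - measure M ((\<Union>i. B i) \<inter> space M)\<bar> < e / 2"
    using e LIMSEQ_D[of "\<lambda>n. measure M (C n \<inter> space M)" "measure M ((\<Union>i. B i) \<inter> space M)" "e / 2"] by auto
  obtain k D where D: "determined k D" "measure M (sym_diff (C n) D \<inter> space M) < e / 2"
    using \<open>cylinder_approximable M (C n)\<close> e unfolding cylinder_approximable_def by meson
  have sub: "C n \<subseteq> (\<Union>i. B i)" by (auto simp: C_def)
  have UB: "(\<Union>i. B i) \<in> sets borel" using B(1) by auto
  note [simp] = determined_borel[OF D(1)] UB C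
  have "measure M (sym_diff (\<Union>i. B i) D \<inter> space M)
      \<le> measure M ((sym_diff (C n) D \<inter> space M) \<union> ((\<Union>i. B i) \<inter> space M - C n \<inter> space M))"
    using sub by (intro finite_measure_mono sets.Un sets.Diff borel_Int_space) auto
  also have "\<dots> \<le> measure M (sym_diff (C n) D \<inter> space M)
      + measure M ((\<Union>i. B i) \<inter> space M - C n \<inter> space M)"
    by (intro measure_Un_le borel_Int_space sets.Un sets.Diff) auto
  also have "measure M ((\<Union>i. B i) \<inter> space M - C n \<inter> space M)
      = measure M ((\<Union>i. B i) \<inter> space M) - measure M (C n \<inter> space M)"
    using sub by (intro finite_measure_Diff borel_Int_space) auto
  finally have "measure M (sym_diff (\<Union>i. B i) D \<inter> space M) < e" using D n by linarith
  then show "\<exists>n D. determined n D \<and> measure M (sym_diff (\<Union>i. B i) D \<inter> space M) < e"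
    using D(1) by blast
qed

text \<open>Induction over the sigma-algebra generated by the open sets. Open sets are countable
  unions of cylinder sets, and complementing both sets does not change their symmetric
  difference.\<close>

lemma borel_approximable:
  assumes "B \<in> sets borel"
  shows "cylinder_approximable M B"
proof -
  have "B \<in> sigma_sets UNIV {S. open S}" using assms by (simp add: borel_def)
  then show ?thesis
  proof induction
    case (Basic U)
    then obtain D where D: "\<And>n. determined n (D n)" "U = (\<Union>n. D n)"
      using open_UN_determined[of U] by auto
    show ?case unfolding D(2)
      using D(1) by (blast intro: approximable_UN determined_borel determined_approximable)
  next
    case Empty
    show ?case by (rule determined_approximable[of 0]) (simp add: determined_def)
  next
    case (Compl B)
    show ?case unfolding cylinder_approximable_def
    proof (intro allI impI)
      fix e :: real assume "0 < e"
      then obtain n D where D: "determined n D" "measure M (sym_diff B D \<inter> space M) < e"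
        using Compl.IH unfolding cylinder_approximable_def by meson
      have "sym_diff (UNIV - B) (- D) = sym_diff B D" by auto
      then show "\<exists>n D. determined n D \<and> measure M (sym_diff (UNIV - B) D \<inter> space M) < e"
        using D determined_Compl[OF D(1)] by metis
    qed
  next
    case (Union B)
    then show ?case by (intro approximable_UN) (auto simp: borel_def)
  qed
qed

text \<open>Each fibre of \<open>f\<close> is approximated by a cylinder set, and \<open>h\<close>
  reads off from the first \<open>k\<close> letters which of these sets is met.\<close>

lemma simple_function_cylinder_approx:
  fixes f :: "(nat \<Rightarrow> 'a) \<Rightarrow> 'b"
  assumes f: "simple_function M f" and e: "0 < e"
  obtains k h where "measure M {x \<in> space M. f x \<noteq> h (map x [0..<k])} \<le> e"
    "simple_function M (\<lambda>x. h (map x [0..<k]))"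
proof -
  define R where "R = f ` space M"
  have R: "finite R" using f by (simp add: R_def simple_functionD)
  \<comment> \<open>The error is shared among the fibres; adding 1 keeps the denominator
    positive.\<close>
  define d where "d = e / (real (card R) + 1)"
  have d: "0 < d" using e by (simp add: d_def add_nonneg_pos)
  have "\<exists>n D. determined n D \<and> measure M (sym_diff (f -` {c}) D \<inter> space M) < d" for c
  proof -
    have "f -` {c} \<inter> space M \<in> sets M" using f by (simp add: simple_functionD)
    then obtain B where B: "B \<in> sets borel" "f -` {c} \<inter> space M = B \<inter> space M"
      by (auto simp: sets_M sets_restrict_space space_restrict)
    obtain n D where D: "determined n D" "measure M (sym_diff B D \<inter> space M) < d"
      using borel_approximable[OF B(1)] d unfolding cylinder_approximable_def by meson
    have "sym_diff (f -` {c}) D \<inter> space M = sym_diff B D \<inter> space M" using B(2) by auto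
    then show ?thesis using D by metis
  qed
  then obtain n D where D: "\<And>c. determined (n c) (D c)"
    "\<And>c. measure M (sym_diff (f -` {c}) (D c) \<inter> space M) < d" by metis
  define k where "k = (\<Sum>c\<in>R. n c)"
  have Dk: "determined k (D c)" if "c \<in> R" for c
    using D(1) by (rule determined_mono) (use that R in \<open>auto simp: k_def intro: member_le_sum\<close>)
  \<comment> \<open>Membership in \<open>D c\<close> ignores the coordinates from \<open>k\<close>
    on, so a word may be extended by an arbitrary value.\<close>
  define ext where "ext w i = (if i < k then w ! i else undefined)" for w :: "'a list" and i
  have ext: "ext (map x [0..<k]) \<in> D c \<longleftrightarrow> x \<in> D c" if "c \<in> R" for x c
    using determinedD[OF Dk[OF that], of x "ext (map x [0..<k])"]
      determinedD[OF Dk[OF that], of "ext (map x [0..<k])" x] by (auto simp: ext_def)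
  \<comment> \<open>The sets \<open>D c\<close> may overlap or miss points, so the choice is
    arbitrary there. Outside the symmetric differences only \<open>c = f x\<close>
    qualifies.\<close>
  define h where "h w = (if \<exists>c\<in>R. ext w \<in> D c then SOME c. c \<in> R \<and> ext w \<in> D c else undefined)" for w
  have hR: "h w \<in> R \<union> {undefined}" for w
  proof (cases "\<exists>c\<in>R. ext w \<in> D c")
    case True
    then have "\<exists>c. c \<in> R \<and> ext w \<in> D c" by blast
    from someI_ex[OF this] have "(SOME c. c \<in> R \<and> ext w \<in> D c) \<in> R" by blast
    then show ?thesis using True by (simp add: h_def)
  qed (simp add: h_def)
  have bad: "{x \<in> space M. f x \<noteq> h (map x [0..<k])} \<subseteq> (\<Union>c\<in>R. sym_diff (f -` {c}) (D c) \<inter> space M)"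
  proof
    fix x assume "x \<in> {x \<in> space M. f x \<noteq> h (map x [0..<k])}"
    then have x: "x \<in> space M" "f x \<noteq> h (map x [0..<k])" by auto
    show "x \<in> (\<Union>c\<in>R. sym_diff (f -` {c}) (D c) \<inter> space M)"
    proof (rule ccontr)
      assume "\<not> ?thesis"
      then have sym: "x \<notin> sym_diff (f -` {c}) (D c)" if "c \<in> R" for c
        using that x(1) by blast
      have good: "x \<in> D c \<longleftrightarrow> f x = c" if "c \<in> R" for c
        using sym[OF that] by (simp only: Un_iff Diff_iff vimage_singleton_eq) argo
      have fx: "f x \<in> R" using x by (simp add: R_def)
      have "\<exists>c\<in>R. ext (map x [0..<k]) \<in> D c" using fx ext[OF fx] good[OF fx] by blast
      moreover have "(SOME c. c \<in> R \<and> ext (map x [0..<k]) \<in> D c) = f x"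
      proof (rule some_equality)
        show "f x \<in> R \<and> ext (map x [0..<k]) \<in> D (f x)" using fx ext[OF fx] good[OF fx] by blast
        show "c = f x" if "c \<in> R \<and> ext (map x [0..<k]) \<in> D c" for c
          using that ext[of c x] good[of c] by blast
      qed
      ultimately show False using x by (simp add: h_def)
    qed
  qed
  have meas: "sym_diff (f -` {c}) (D c) \<inter> space M \<in> sets M" for c
  proof -
    have "sym_diff (f -` {c}) (D c) \<inter> space M
        = sym_diff (f -` {c} \<inter> space M) (D c \<inter> space M)" by auto
    then show ?thesis using f borel_Int_space[OF determined_borel[OF D(1)[of c]]]
      by (auto simp: simple_functionD)
  qed
  have "measure M {x \<in> space M. f x \<noteq> h (map x [0..<k])}
      \<le> measure M (\<Union>c\<in>R. sym_diff (f -` {c}) (D c) \<inter> space M)"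
    by (rule finite_measure_mono[OF bad]) (rule sets.finite_UN[OF R meas])
  also have "\<dots> \<le> (\<Sum>c\<in>R. measure M (sym_diff (f -` {c}) (D c) \<inter> space M))"
    by (rule measure_UNION_le[OF R meas])
  also have "\<dots> \<le> (\<Sum>c\<in>R. d)" using D(2) by (intro sum_mono less_imp_le)
  also have "\<dots> \<le> e" using e by (simp add: d_def field_simps)
  finally have "measure M {x \<in> space M. f x \<noteq> h (map x [0..<k])} \<le> e" .
  moreover have "simple_function M (\<lambda>x. h (map x [0..<k]))"
    unfolding simple_function_def
  proof (intro conjI ballI)
    show "finite ((\<lambda>x. h (map x [0..<k])) ` space M)"
      by (rule finite_subset[of _ "R \<union> {undefined}"]) (use hR R in auto)
    fix c
    have "determined k {x. h (map x [0..<k]) = c}" by (rule determined_words)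
    from borel_Int_space[OF determined_borel[OF this]]
    show "(\<lambda>x. h (map x [0..<k])) -` {c} \<inter> space M \<in> sets M" by (simp add: vimage_def)
  qed
  ultimately show thesis by (rule that)
qed

end


section \<open>Entropy of finite partitions under a measure-preserving map\<close>

lemma itinerary_add:
  "itinerary T f (m + n) x = itinerary T f m x @ itinerary T f n ((T ^^ m) x)"
  unfolding itinerary_def
  by (rule nth_equalityI) (auto simp: nth_append funpow_add[symmetric, THEN fun_cong, unfolded o_apply])

lemma length_itinerary [simp]: "length (itinerary T f n x) = n"
  by (simp add: itinerary_def)

context prob_space
begin

interpretation information_space M "exp 1" by unfold_locales simp

lemma partition_entropy_data_processing:
  "simple_function M f \<Longrightarrow> partition_entropy M (\<lambda>x. h (f x)) \<le> partition_entropy M f"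
  unfolding partition_entropy_def using entropy_data_processing[of f h] by (simp add: comp_def)

lemma partition_entropy_Pair:
  assumes "simple_function M f" "simple_function M g"
  shows "partition_entropy M (\<lambda>x. (f x, g x)) \<le> partition_entropy M f + partition_entropy M g"
  unfolding partition_entropy_def
  using entropy_chain_rule[OF assms] conditional_entropy_less_eq_entropy[OF assms(2,1)] by linarith

lemma partition_entropy_nonneg:
  assumes "simple_function M f"
  shows "0 \<le> partition_entropy M f"
proof -
  have "p * ln p \<le> 0" if "0 \<le> p" "p \<le> 1" for p :: real
    using that by (cases "p = 0") (auto intro!: mult_nonneg_nonpos)
  then show ?thesis
    unfolding partition_entropy_eq[OF prob_space_axioms assms] using sum_nonpos by (simp add: sum_nonpos)
qed

lemma expectation_simple:
  fixes q :: "'b \<Rightarrow> real"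
  assumes f: "simple_function M f"
  shows "(\<integral>x. q (f x) \<partial>M) = (\<Sum>c\<in>f ` space M. prob {x \<in> space M. f x = c} * q c)"
proof -
  have meas: "{x \<in> space M. f x = c} \<in> sets M" for c
    using simple_functionD(2)[OF f, of "{c}"] by (simp add: vimage_def Int_def conj_commute)
  have "(\<integral>x. q (f x) \<partial>M) =
      (\<integral>x. (\<Sum>c\<in>f ` space M. q c * indicator {x \<in> space M. f x = c} x) \<partial>M)"
  proof (rule Bochner_Integration.integral_cong)
    fix x assume x: "x \<in> space M"
    have "(\<Sum>c\<in>f ` space M. q c * indicator {x \<in> space M. f x = c} x)
        = (\<Sum>c\<in>f ` space M. if c = f x then q c else 0)"
      using x by (intro sum.cong) (auto simp: indicator_def)
    then show "q (f x) = (\<Sum>c\<in>f ` space M. q c * indicator {x \<in> space M. f x = c} x)"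
      using x simple_functionD(1)[OF f] by simp
  qed simp
  also have "\<dots> = (\<Sum>c\<in>f ` space M. prob {x \<in> space M. f x = c} * q c)"
    using meas
    by (subst Bochner_Integration.integral_sum) (auto intro!: sum.cong integrable_mult_right integrable_real_indicator simp: emeasure_eq_measure)
  finally show ?thesis .
qed

text \<open>Gibbs' inequality for weights that need not sum to one: average
  \<open>ln t \<le> t - 1\<close> at \<open>t = q c / (Z * p c)\<close> against the cell
  probabilities \<open>p c\<close>.\<close>

lemma partition_entropy_Gibbs:
  fixes q :: "'b \<Rightarrow> real"
  assumes f: "simple_function M f" and q: "\<And>x. x \<in> space M \<Longrightarrow> 0 < q (f x)"
    and Z: "(\<Sum>c\<in>f ` space M. q c) \<le> Z"
  shows "partition_entropy M f \<le> ln Z - (\<integral>x. ln (q (f x)) \<partial>M)"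
proof -
  define p where "p c = prob {x \<in> space M. f x = c}" for c
  let ?R = "f ` space M"
  have R: "finite ?R" using f by (rule simple_functionD)
  have sum_p: "(\<Sum>c\<in>?R. p c) = 1"
    using expectation_simple[OF f, of "\<lambda>_. 1"] by (simp add: p_def prob_space)
  obtain x where "x \<in> space M" using not_empty by blast
  then have "0 < (\<Sum>c\<in>?R. q c)" using q R by (intro sum_pos) auto
  then have Zpos: "0 < Z" using Z by simp
  \<comment> \<open>Cells of probability zero are treated apart: there the left side is 0 and the
    right side is nonnegative.\<close>
  have bound: "p c * (ln (q c) - ln Z) - p c * ln (p c) \<le> q c / Z - p c" if "c \<in> ?R" for c
  proof (cases "p c = 0")
    case True
    then show ?thesis using that q Zpos by (auto intro!: divide_nonneg_pos less_imp_le)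
  next
    case False
    then have pc: "0 < p c" by (simp add: p_def zero_less_measure_iff)
    have qc: "0 < q c" using that q by auto
    have "ln (q c / Z / p c) \<le> q c / Z / p c - 1"
      using pc qc Zpos by (intro ln_le_minus_one) simp
    then have "p c * (ln (q c) - ln Z - ln (p c)) \<le> p c * (q c / Z / p c - 1)"
      using pc qc Zpos by (simp add: ln_div ln_mult)
    also have "\<dots> = q c / Z - p c" using pc by (simp add: field_simps)
    finally show ?thesis by (simp add: algebra_simps)
  qed
  have "(\<Sum>c\<in>?R. p c * (ln (q c) - ln Z) - p c * ln (p c)) \<le> (\<Sum>c\<in>?R. q c / Z - p c)"
    by (intro sum_mono bound)
  also have "\<dots> = (\<Sum>c\<in>?R. q c) / Z - 1"
    by (simp add: sum_subtractf sum_p flip: sum_divide_distrib)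
  also have "\<dots> \<le> 0" using Z Zpos by simp
  finally have "(\<Sum>c\<in>?R. p c * ln (q c)) - ln Z - (\<Sum>c\<in>?R. p c * ln (p c)) \<le> 0"
    by (simp add: sum_subtractf right_diff_distrib sum_p flip: sum_distrib_right)
  then show ?thesis
    unfolding partition_entropy_eq[OF prob_space_axioms f] expectation_simple[OF f, of "\<lambda>c. ln (q c)"]
    by (simp add: p_def)
qed

end

section \<open>Entropy along the orbits of a measure-preserving map\<close>

locale measure_preserving = prob_space M for M :: "'x measure" +
  fixes T :: "'x \<Rightarrow> 'x"
  assumes measurable_T: "T \<in> measurable M M" and distr_T: "distr M M T = M"
begin

lemma measurable_funpow: "T ^^ n \<in> measurable M M"
proof (induction n)
  case 0
  show ?case by (simp add: id_def)
next
  case (Suc n)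
  show ?case unfolding funpow.simps by (rule measurable_comp[OF Suc measurable_T])
qed

lemma distr_funpow: "distr M M (T ^^ n) = M"
proof (induction n)
  case 0
  show ?case by (simp add: id_def distr_id)
next
  case (Suc n)
  have "distr M M (T ^^ Suc n) = distr (distr M M (T ^^ n)) M T"
    by (simp add: distr_distr[OF measurable_T measurable_funpow])
  then show ?case by (simp only: Suc distr_T)
qed

lemma simple_function_funpow:
  assumes "simple_function M f"
  shows "simple_function M (\<lambda>x. f ((T ^^ n) x))"
  using assms measurable_comp[OF measurable_funpow, of f "count_space UNIV" n] measurable_space[OF measurable_funpow[of n]]
  unfolding simple_function_eq_measurable comp_def
  by (auto elim: finite_subset[rotated])

lemma prob_funpow:
  assumes "A \<in> sets M"
  shows "prob {x \<in> space M. (T ^^ n) x \<in> A} = prob A"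
proof -
  have "prob A = measure (distr M M (T ^^ n)) A" by (simp add: distr_funpow)
  also have "\<dots> = prob ((T ^^ n) -` A \<inter> space M)" by (rule measure_distr[OF measurable_funpow assms])
  finally show ?thesis by (simp add: vimage_def Int_def conj_commute)
qed

lemma partition_entropy_funpow:
  assumes f: "simple_function M f"
  shows "partition_entropy M (\<lambda>x. f ((T ^^ n) x)) = partition_entropy M f"
proof -
  let ?g = "\<lambda>x. f ((T ^^ n) x)"
  have meas: "{x \<in> space M. f x = c} \<in> sets M" for c
    using simple_functionD(2)[OF f, of "{c}"] by (simp add: vimage_def Int_def conj_commute)
  have into: "(T ^^ n) x \<in> space M" if "x \<in> space M" for x
    using measurable_space[OF measurable_funpow that] .
  have prob: "prob {x \<in> space M. ?g x = c} = prob {x \<in> space M. f x = c}" for c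
  proof -
    have "{x \<in> space M. ?g x = c} = {x \<in> space M. (T ^^ n) x \<in> {x \<in> space M. f x = c}}"
      using into by auto
    then show ?thesis by (simp only: prob_funpow[OF meas])
  qed
  \<comment> \<open>The composite may take fewer values than \<open>f\<close>, but by invariance the
    missing ones have probability zero.\<close>
  have empty: "prob {x \<in> space M. f x = c} = 0" if "c \<notin> ?g ` space M" for c
  proof -
    have "{x \<in> space M. ?g x = c} = {}" using that by auto
    then have "prob {x \<in> space M. ?g x = c} = 0" by (simp only: measure_empty)
    then show ?thesis by (simp only: prob)
  qed
  have "(\<Sum>c\<in>?g ` space M. prob {x \<in> space M. f x = c} * ln (prob {x \<in> space M. f x = c}))
      = (\<Sum>c\<in>f ` space M. prob {x \<in> space M. f x = c} * ln (prob {x \<in> space M. f x = c}))"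
    using into empty simple_functionD(1)[OF f] by (intro sum.mono_neutral_left) auto
  then show ?thesis
    unfolding partition_entropy_eq[OF prob_space_axioms f]
      partition_entropy_eq[OF prob_space_axioms simple_function_funpow[OF f]] prob by simp
qed

lemma simple_function_itinerary:
  assumes f: "simple_function M f"
  shows "simple_function M (itinerary T f n)"
proof (induction n)
  case 0
  have "itinerary T f 0 = (\<lambda>x. [])" by (simp add: itinerary_def fun_eq_iff)
  then show ?case by simp
next
  case (Suc n)
  have "itinerary T f (Suc n) = (\<lambda>x. itinerary T f n x @ [f ((T ^^ n) x)])"
    by (simp add: itinerary_def fun_eq_iff)
  then show ?case using simple_function_compose2[OF Suc simple_function_funpow[OF f], of "\<lambda>w a. w @ [a]"] by simp
qed

lemma partition_entropy_itinerary_add: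
  assumes f: "simple_function M f"
  shows "partition_entropy M (itinerary T f (m + n))
    \<le> partition_entropy M (itinerary T f m) + partition_entropy M (itinerary T f n)"
proof -
  note sm = simple_function_itinerary[OF f, of m]
  note sn = simple_function_funpow[OF simple_function_itinerary[OF f, of n], of m]
  have "itinerary T f (m + n) = (\<lambda>x. case_prod (@) (itinerary T f m x, itinerary T f n ((T ^^ m) x)))"
    by (simp add: itinerary_add fun_eq_iff)
  then have "partition_entropy M (itinerary T f (m + n)) \<le>
      partition_entropy M (\<lambda>x. (itinerary T f m x, itinerary T f n ((T ^^ m) x)))"
    by (simp only:) (rule partition_entropy_data_processing[OF simple_function_Pair[OF sm sn]])
  also have "\<dots> \<le> partition_entropy M (itinerary T f m)
      + partition_entropy M (\<lambda>x. itinerary T f n ((T ^^ m) x))"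
    by (rule partition_entropy_Pair[OF sm sn])
  also have "partition_entropy M (\<lambda>x. itinerary T f n ((T ^^ m) x)) = partition_entropy M (itinerary T f n)"
    by (rule partition_entropy_funpow[OF simple_function_itinerary[OF f]])
  finally show ?thesis .
qed

lemma entropy_wrt_partition_LIMSEQ:
  assumes f: "simple_function M f"
  shows "(\<lambda>n. partition_entropy M (itinerary T f n) / real n) \<longlonglongrightarrow> entropy_wrt_partition M T f"
  unfolding entropy_wrt_partition_def convergent_LIMSEQ_iff[symmetric]
  by (intro fekete_convergent partition_entropy_nonneg partition_entropy_itinerary_add simple_function_itinerary f)

lemma entropy_wrt_partition_nonneg:
  assumes f: "simple_function M f"
  shows "0 \<le> entropy_wrt_partition M T f"
  by (rule LIMSEQ_le_const[OF entropy_wrt_partition_LIMSEQ[OF f]])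
     (auto intro!: divide_nonneg_nonneg partition_entropy_nonneg simple_function_itinerary f)

text \<open>The trivial partition already gives this. It saves computing the entropy of the point
  mass, whose free energy is bounded above by the general estimate.\<close>

lemma measure_entropy_nonneg: "0 \<le> measure_entropy M T"
  unfolding measure_entropy_def
  by (rule SUP_upper2[of "\<lambda>_. 0"]) (auto intro: entropy_wrt_partition_nonneg)

lemma partition_entropy_itinerary_le:
  assumes f: "simple_function M f"
  shows "partition_entropy M (itinerary T f n) \<le> real n * partition_entropy M f"
proof (induction n)
  case 0
  \<comment> \<open>Itineraries of length 0 have a single cell, so Gibbs' inequality with constant
    weight 1 bounds the entropy by \<open>ln 1\<close>.\<close>
  have "(\<Sum>c\<in>itinerary T f 0 ` space M. 1::real) \<le> 1"
    using card_mono[of "{[]}" "itinerary T f 0 ` space M"] by (auto simp: itinerary_def)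
  from partition_entropy_Gibbs[OF simple_function_itinerary[OF f, of 0], of "\<lambda>_. 1", OF _ this]
  show ?case by simp
next
  case (Suc n)
  have "partition_entropy M (itinerary T f 1) \<le> partition_entropy M f"
    using partition_entropy_data_processing[OF f, of "\<lambda>a. [a]"] by (simp add: itinerary_def[abs_def])
  then show ?case
    using partition_entropy_itinerary_add[OF f, of n 1] Suc by (simp add: algebra_simps)
qed

text \<open>
  This replaces the Kolmogorov--Sinai theorem: \<open>P\<close> will be the generating partition and \<open>E\<close> the
  correction, of small entropy, of a cylinder approximation to \<open>f\<close>.
\<close>

lemma partition_entropy_itinerary_decode:
  assumes P: "simple_function M P" and E: "simple_function M E"
    and dec: "\<And>x. x \<in> space M \<Longrightarrow> f x = dec (itinerary T P k x) (E x)"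
    and f: "simple_function M f"
  shows "partition_entropy M (itinerary T f n)
    \<le> partition_entropy M (itinerary T P (n + k)) + real n * partition_entropy M E"
proof -
  \<comment> \<open>The value of \<open>f\<close> at time \<open>i\<close> is decoded from the
    window of length \<open>k\<close> starting at \<open>i\<close>. The last windows reach beyond
    time \<open>n\<close>, which is why \<open>n + k\<close> letters are needed.\<close>
  define h where "h = (\<lambda>(w, e). map (\<lambda>i. dec (take k (drop i w)) (e ! i)) [0..<n])"
  note sP = simple_function_itinerary[OF P, of "n + k"] and sE = simple_function_itinerary[OF E, of n]
  let ?F = "\<lambda>x. (itinerary T P (n + k) x, itinerary T E n x)"
  have eq: "itinerary T f n x = h (?F x)" if x: "x \<in> space M" for x
  proof (rule nth_equalityI)
    fix i assume "i < length (itinerary T f n x)"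
    then have i: "i < n" by simp
    have "itinerary T P (n + k) x = itinerary T P (i + (k + (n - i))) x" using i by (simp add: add.commute)
    also have "\<dots> = itinerary T P i x @ itinerary T P k ((T ^^ i) x) @
        itinerary T P (n - i) ((T ^^ k) ((T ^^ i) x))"
      by (simp only: itinerary_add)
    finally have "take k (drop i (itinerary T P (n + k) x)) = itinerary T P k ((T ^^ i) x)" by simp
    moreover have "(T ^^ i) x \<in> space M" using measurable_space[OF measurable_funpow x] .
    ultimately show "itinerary T f n x ! i = h (?F x) ! i"
      using i by (simp add: h_def dec) (simp add: itinerary_def dec)
  qed (simp add: h_def)
  \<comment> \<open>The two functions are known to agree on \<open>space M\<close> only, so their
    entropies are compared through the measures of the fibres.\<close>
  have "partition_entropy M (itinerary T f n) = partition_entropy M (\<lambda>x. h (?F x))"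
    unfolding partition_entropy_eq[OF prob_space_axioms simple_function_itinerary[OF f]]
      partition_entropy_eq[OF prob_space_axioms simple_function_compose1[OF simple_function_Pair[OF sP sE]]]
    using eq by (simp cong: image_cong conj_cong)
  also have "\<dots> \<le> partition_entropy M ?F"
    by (rule partition_entropy_data_processing[OF simple_function_Pair[OF sP sE]])
  also have "\<dots> \<le> partition_entropy M (itinerary T P (n + k)) + partition_entropy M (itinerary T E n)"
    by (rule partition_entropy_Pair[OF sP sE])
  finally show ?thesis using partition_entropy_itinerary_le[OF E, of n] by linarith
qed

end


section \<open>Invariant measures of the run shift\<close>

text \<open>Gibbs' inequality with weight 1 on the dominant value \<open>a\<close> and weight
  \<open>d\<close> on every other value.\<close>

lemma (in prob_space) partition_entropy_concentrated:
  assumes E: "simple_function M E" and R: "finite R" "E ` space M \<subseteq> insert a R"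
    and d: "0 < d" "d \<le> 1"
  shows "partition_entropy M E \<le> ln (1 + real (card R) * d) + ln (1 / d) * prob {x \<in> space M. E x \<noteq> a}"
proof -
  define q where "q c = (if c = a then 1 else d)" for c
  have meas: "{x \<in> space M. E x \<noteq> a} \<in> sets M"
    using simple_functionD(2)[OF E, of "- {a}"] by (simp add: vimage_def Int_def conj_commute)
  have "(\<Sum>c\<in>E ` space M. q c) \<le> (\<Sum>c\<in>insert a R. q c)"
    using R d by (intro sum_mono2) (auto simp: q_def)
  also have "\<dots> = q a + (\<Sum>c\<in>R - {a}. q c)" using R by (simp add: sum.insert_remove)
  also have "(\<Sum>c\<in>R - {a}. q c) = real (card (R - {a})) * d" by (simp add: q_def)
  also have "q a + real (card (R - {a})) * d \<le> 1 + real (card R) * d"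
    using R d by (intro add_mono mult_right_mono) (auto simp: q_def card_Diff1_le)
  finally have "partition_entropy M E \<le> ln (1 + real (card R) * d) - (\<integral>x. ln (q (E x)) \<partial>M)"
    using d by (intro partition_entropy_Gibbs[OF E]) (auto simp: q_def)
  also have "(\<integral>x. ln (q (E x)) \<partial>M) = (\<integral>x. ln d * indicator {x \<in> space M. E x \<noteq> a} x \<partial>M)"
    by (intro Bochner_Integration.integral_cong) (auto simp: q_def indicator_def)
  also have "\<dots> = ln d * prob {x \<in> space M. E x \<noteq> a}" using meas by simp
  finally show ?thesis using d by (simp add: ln_div)
qed

text \<open>First \<open>d\<close> is chosen to make the first term small, then \<open>p\<close> in
  terms of \<open>d\<close> to control the factor \<open>ln (1 / d)\<close>.\<close>

lemma small_entropy_bound: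
  fixes e :: real
  assumes "0 < e"
  obtains d p where "0 < d" "d \<le> 1" "0 < p"
    "\<And>r. r \<le> p \<Longrightarrow> ln (1 + real m * d) + ln (1 / d) * r \<le> e"
proof -
  define d where "d = min 1 (e / (2 * (real m + 1)))"
  have d: "0 < d" "d \<le> 1" using assms by (auto simp: d_def)
  define p where "p = e / (2 * (ln (1 / d) + 1))"
  have l: "0 \<le> ln (1 / d)" using d by simp
  have p: "0 < p" unfolding p_def using assms l by (intro divide_pos_pos) auto
  have "real m * d \<le> real m * (e / (2 * (real m + 1)))" by (intro mult_left_mono) (auto simp: d_def)
  also have "\<dots> \<le> e / 2" using assms by (simp add: field_simps)
  finally have 1: "ln (1 + real m * d) \<le> e / 2"
    using ln_add_one_self_le_self[of "real m * d"] d by simp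
  have "ln (1 / d) * r \<le> e / 2" if "r \<le> p" for r
  proof -
    have "ln (1 / d) * r \<le> ln (1 / d) * p" using l that by (rule mult_left_mono[rotated])
    also have "\<dots> \<le> e / 2" using l assms unfolding p_def by (simp add: field_simps)
    finally show ?thesis .
  qed
  with 1 d p show thesis by (intro that[of d p]) force+
qed

section \<open>The shift, the potential and bounds for invariant measures\<close>

lemma shift_funpow: "(shift ^^ i) x n = x (n + i)"
  by (induction i arbitrary: n) (auto simp: shift_def)

lemma itinerary_shift: "itinerary shift (\<lambda>x. x 0) n x = map x [0..<n]"
  by (simp add: itinerary_def shift_funpow)

lemma continuous_shift: "continuous_on UNIV (shift :: (nat \<Rightarrow> 'a::topological_space) \<Rightarrow> _)"
  unfolding shift_def
  by (intro continuous_on_coordinatewise_then_product continuous_on_product_coordinates)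

text \<open>The price of a letter one exceeds the entropy rate \<open>ln (2 * N)\<close> by 1, so
  the free energy falls short of 0 by at least the probability of a one.\<close>

definition potential :: "nat \<Rightarrow> (nat \<Rightarrow> nat) \<Rightarrow> real" where
  "potential N x = (if x 0 = 1 then - (ln (2 * real N) + 1) else 0)"

locale run_shift_measure =
  fixes N :: nat and M :: "(nat \<Rightarrow> nat) measure"
  assumes N: "2 \<le> N" and invariant: "M \<in> invariant_measures (run_shift N)"
begin

lemma sets_M: "sets M = sets (restrict_space borel (run_shift N))"
  and prob_M: "prob_space M" and meas_shift: "shift \<in> measurable M M" and distr_shift: "distr M M shift = M"
  using invariant by (auto simp: invariant_measures_def)

sublocale measure_preserving M shift
  by (intro measure_preserving.intro prob_M measure_preserving_axioms.intro meas_shift distr_shift)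

lemma space_M: "space M = run_shift N"
  by (rule space_restrict[OF finite_measure_axioms sets_M])

lemma determined_sets:
  assumes "determined n {x. P x}"
  shows "{x \<in> space M. P x} \<in> sets M"
  using borel_Int_space[OF finite_measure_axioms sets_M determined_borel[OF assms]]
  by (simp add: Int_def conj_commute)

definition one_prob :: real where
  "one_prob = prob {x \<in> space M. x 0 = 1}"

lemma coordinate_sets: "{x \<in> space M. x i = c} \<in> sets M"
  by (rule determined_sets[of "Suc i"]) (auto intro!: determinedI)

lemma prob_coordinate: "prob {x \<in> space M. x i = 1} = one_prob"
proof -
  have "{x \<in> space M. x i = 1} = {x \<in> space M. (shift ^^ i) x \<in> {x \<in> space M. x 0 = 1}}"
    using measurable_space[OF measurable_funpow[of i]] by (auto simp: shift_funpow)
  then show ?thesis by (simp only: one_prob_def prob_funpow[OF coordinate_sets])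
qed

lemma simple_function_coordinate: "simple_function M (\<lambda>x. x 0)"
proof -
  have "x 0 \<in> {0, 1}" if "x \<in> space M" for x
    using that shift_space_run_shift[of N] by (auto simp: space_M shift_space_def)
  then have "(\<lambda>x. x 0) ` space M \<subseteq> {0, 1}" by (rule image_subsetI)
  then have "finite ((\<lambda>x. x 0) ` space M)" by (rule finite_subset) simp
  then show ?thesis
    using coordinate_sets[of 0] by (auto simp: simple_function_def vimage_def Int_def conj_commute)
qed

text \<open>Gibbs' inequality with weight \<open>s\<close> per letter one: the total weight is the
  linear bound for admissible words, and by invariance each of the \<open>n\<close> coordinates
  contributes \<open>ln s * one_prob\<close> to the mean logarithmic weight.\<close>

lemma partition_entropy_words:
  assumes n: "1 \<le> n"
  shows "partition_entropy M (itinerary shift (\<lambda>x. x 0) n)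
    \<le> ln (2 * real N * real n) + real n * (ln (2 * real N) * one_prob)"
proof -
  let ?W = "itinerary shift (\<lambda>x. x 0) n"
  define s where "s = 1 / (2 * real N)"
  have s: "0 < s" using N by (simp add: s_def)
  have range: "?W ` space M \<subseteq> admissible_words N n"
    by (auto simp: itinerary_shift space_M run_shift_def admissible_words_def)
  have "(\<Sum>w\<in>?W ` space M. s ^ count_list w 1) \<le> 2 * real N * real n"
    using weight_sum_mono[OF _ finite_admissible_words range, of s] s weight_sum_admissible_words[OF N n]
    by (simp add: weight_sum_def s_def)
  then have "partition_entropy M ?W \<le> ln (2 * real N * real n) - (\<integral>x. ln (s ^ count_list (?W x) 1) \<partial>M)"
    using s by (intro partition_entropy_Gibbs simple_function_itinerary simple_function_coordinate) auto
  also have "(\<integral>x. ln (s ^ count_list (?W x) 1) \<partial>M)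
      = (\<integral>x. (\<Sum>i<n. ln s * indicator {x \<in> space M. x i = 1} x) \<partial>M)"
  proof (rule Bochner_Integration.integral_cong)
    fix x assume x: "x \<in> space M"
    have "real (count_list (map x [0..<n]) 1) = (\<Sum>i<n. indicator {x \<in> space M. x i = 1} x)"
      using x by (induction n) (auto simp: indicator_def)
    then show "ln (s ^ count_list (?W x) 1) = (\<Sum>i<n. ln s * indicator {x \<in> space M. x i = 1} x)"
      using s by (simp add: itinerary_shift ln_realpow sum_distrib_left mult.commute)
  qed simp
  also have "\<dots> = (\<Sum>i<n. ln s * one_prob)"
    using coordinate_sets prob_coordinate
    by (subst Bochner_Integration.integral_sum)
       (auto intro!: sum.cong integrable_mult_right integrable_real_indicator simp: emeasure_eq_measure)
  finally show ?thesis using N by (simp add: s_def ln_div)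
qed

text \<open>Up to a correction of entropy at most \<open>e\<close>, the partition \<open>f\<close>
  is read off from \<open>k\<close> letters. Its itineraries thus cost no more than words of length
  \<open>n + k\<close> plus \<open>n * e\<close>, and after division by \<open>n\<close> the
  logarithmic term vanishes.\<close>

lemma entropy_wrt_partition_le:
  fixes f :: "(nat \<Rightarrow> nat) \<Rightarrow> nat"
  assumes f: "simple_function M f"
  shows "entropy_wrt_partition M shift f \<le> ln (2 * real N) * one_prob"
proof (rule field_le_epsilon)
  fix e :: real assume "0 < e"
  define R where "R = Suc ` f ` space M"
  have R: "finite R" using f by (simp add: R_def simple_functionD)
  obtain d p where dp: "0 < d" "d \<le> 1" "0 < p"
    "\<And>r. r \<le> p \<Longrightarrow> ln (1 + real (card R) * d) + ln (1 / d) * r \<le> e"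
    using small_entropy_bound[OF \<open>0 < e\<close>] by metis
  obtain k h where hk: "prob {x \<in> space M. f x \<noteq> h (map x [0..<k])} \<le> p"
    "simple_function M (\<lambda>x. h (map x [0..<k]))"
    using simple_function_cylinder_approx[OF finite_measure_axioms sets_M f dp(3)] .
  \<comment> \<open>The value 0 means that the cylinder guess is right; otherwise the true value is
    stored, raised by one to stay apart from 0.\<close>
  define E where "E x = (if f x = h (map x [0..<k]) then 0 else Suc (f x))" for x
  have E: "simple_function M E"
    unfolding E_def using simple_function_compose2[OF f hk(2), of "\<lambda>a b. if a = b then 0 else Suc a"] by simp
  have "partition_entropy M E \<le> ln (1 + real (card R) * d) + ln (1 / d) * prob {x \<in> space M. E x \<noteq> 0}"
    by (rule partition_entropy_concentrated[OF E R _ dp(1,2)]) (auto simp: E_def R_def)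
  also have "{x \<in> space M. E x \<noteq> 0} = {x \<in> space M. f x \<noteq> h (map x [0..<k])}"
    by (auto simp: E_def)
  also have "ln (1 + real (card R) * d) + ln (1 / d) * prob \<dots> \<le> e" by (rule dp(4)[OF hk(1)])
  finally have HE: "partition_entropy M E \<le> e" .
  define b where "b = ln (2 * real N) * one_prob"
  define a where "a = ln (2 * real N * real (k + 1))"
  let ?B = "\<lambda>n. a / real n + ln (real n) / real n + (1 + real k / real n) * b + e"
  have "partition_entropy M (itinerary shift f n) / real n \<le> ?B n" if n: "1 \<le> n" for n
  proof -
    have "partition_entropy M (itinerary shift f n)
        \<le> partition_entropy M (itinerary shift (\<lambda>x. x 0) (n + k)) + real n * partition_entropy M E"
      by (rule partition_entropy_itinerary_decode[where dec = "\<lambda>w e. if e = 0 then h w else e - 1"])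
         (auto simp: E itinerary_shift f simple_function_coordinate E_def)
    also have "\<dots> \<le> (ln (2 * real N * real (n + k)) + real (n + k) * b) + real n * e"
      using partition_entropy_words[of "n + k"] n HE by (intro add_mono mult_left_mono) (auto simp: b_def)
    also have "ln (2 * real N * real (n + k)) \<le> ln (2 * real N * real (k + 1) * real n)"
    proof -
      \<comment> \<open>This separates \<open>k\<close> from \<open>n\<close>, so that the logarithm
        splits into the constant \<open>a\<close> and \<open>ln n\<close>.\<close>
      have "n + k \<le> (k + 1) * n" using n by (cases n) auto
      then have "real (n + k) \<le> real (k + 1) * real n" by (simp only: of_nat_le_iff flip: of_nat_mult)
      then have "2 * real N * real (n + k) \<le> 2 * real N * (real (k + 1) * real n)"
        by (intro mult_left_mono) auto
      then show ?thesis using N n by (intro ln_mono) (auto simp: mult.assoc)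
    qed
    also have "\<dots> = a + ln (real n)" using N n by (simp add: a_def ln_mult)
    finally have "partition_entropy M (itinerary shift f n) / real n
        \<le> (a + ln (real n) + real (n + k) * b + real n * e) / real n"
      by (simp add: divide_right_mono)
    also have "\<dots> = ?B n" using n by (simp add: field_simps)
    finally show ?thesis .
  qed
  moreover have "?B \<longlonglongrightarrow> 0 + 0 + (1 + 0) * b + e"
    by (intro tendsto_intros lim_const_over_n lim_ln_over_n)
  ultimately show "entropy_wrt_partition M shift f \<le> ln (2 * real N) * one_prob + e"
    using LIMSEQ_le[OF entropy_wrt_partition_LIMSEQ[OF f], of ?B] by (auto simp: b_def)
qed

lemma measure_entropy_le: "measure_entropy M shift \<le> ereal (ln (2 * real N) * one_prob)"
  unfolding measure_entropy_def using entropy_wrt_partition_le by (auto intro!: SUP_least)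

lemma integral_potential: "(\<integral>x. potential N x \<partial>M) = - (ln (2 * real N) + 1) * one_prob"
proof -
  have "(\<integral>x. potential N x \<partial>M)
      = (\<integral>x. - (ln (2 * real N) + 1) * indicator {x \<in> space M. x 0 = 1} x \<partial>M)"
    by (intro Bochner_Integration.integral_cong) (auto simp: potential_def)
  then show ?thesis using coordinate_sets[of 0 1] by (simp add: one_prob_def)
qed

lemma free_energy_le: "free_energy (potential N) M \<le> ereal (- one_prob)"
proof -
  have "free_energy (potential N) M \<le> ereal (ln (2 * real N) * one_prob) + ereal (- (ln (2 * real N) + 1) * one_prob)"
    unfolding free_energy_def integral_potential by (intro add_mono measure_entropy_le order_refl)
  then show ?thesis by (simp add: algebra_simps)
qed

text \<open>By invariance every coordinate differs from 1 almost surely. Countably many null sets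
  are discarded, and only the zero sequence remains.\<close>

lemma eq_return:
  assumes "one_prob = 0"
  shows "M = return (restrict_space borel (run_shift N)) (\<lambda>_. 0)"
proof -
  have "AE x in M. x i \<noteq> 1" for i
    using prob_coordinate[of i] assms coordinate_sets[of i 1]
    by (subst AE_iff_measurable[where N = "{x \<in> space M. x i = 1}"]) (auto simp: emeasure_eq_measure)
  then have "AE x in M. \<forall>i. x i \<noteq> 1" by (simp add: AE_all_countable)
  with AE_space have zero: "AE x in M. x = (\<lambda>_. 0)"
  proof eventually_elim
    case (elim x)
    then have "x i \<in> {0, 1}" "x i \<noteq> 1" for i
      using shift_space_run_shift[of N] by (auto simp: space_M shift_space_def Pi_iff)
    then show ?case by (intro ext) auto
  qed
  show ?thesis
  proof (rule measure_eqI)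
    show "sets M = sets (return (restrict_space borel (run_shift N)) (\<lambda>_. 0))" by (simp add: sets_M)
    fix A assume A: "A \<in> sets M"
    have "emeasure M A = indicator A (\<lambda>_. 0)"
    proof (cases "(\<lambda>_. 0) \<in> A")
      case True
      have "AE x in M. x \<in> A" using zero by eventually_elim (simp add: True)
      then show ?thesis using True emeasure_eq_1_AE[OF A] by simp
    next
      case False
      have "AE x in M. x \<notin> A" using zero by eventually_elim (use False in auto)
      moreover have "{x \<in> space M. x \<in> A} = A" using sets.sets_into_space[OF A] by auto
      ultimately show ?thesis using False emeasure_eq_0_AE[of "\<lambda>x. x \<in> A" M] by simp
    qed
    then show "emeasure M A = emeasure (return (restrict_space borel (run_shift N)) (\<lambda>_. 0)) A"
      using A by (simp add: sets_M)
  qed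
qed

end


section \<open>The equilibrium state\<close>

text \<open>Every forbidden word with \<open>k \<ge> 1\<close> contains a one.\<close>

lemma zero_run_shift: "(\<lambda>_. 0) \<in> run_shift N"
proof -
  have "admissible N (replicate n 0)" for n
  proof -
    have "\<not> sublist (forbidden N k) (replicate n 0)" if "1 \<le> k" for k
    proof
      assume "sublist (forbidden N k) (replicate n 0)"
      moreover have "1 \<in> set (forbidden N k)" using that by (simp add: forbidden_def)
      ultimately have "1 \<in> set (replicate n (0::nat))" using set_mono_sublist by blast
      then show False by simp
    qed
    then show ?thesis by (auto simp: admissible_def)
  qed
  then show ?thesis by (simp add: run_shift_def map_replicate_const)
qed

lemma return_invariant:
  "return (restrict_space borel (run_shift N)) (\<lambda>_. 0) \<in> invariant_measures (run_shift N)"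
proof -
  let ?R = "restrict_space borel (run_shift N)"
  let ?r = "return ?R (\<lambda>_. 0)"
  have in_space: "(\<lambda>_. 0) \<in> space ?R" by (simp add: space_restrict_space zero_run_shift)
  have "shift ` run_shift N \<subseteq> run_shift N" using shift_space_run_shift by (simp add: shift_space_def)
  then have meas: "shift \<in> measurable ?R ?R"
    using borel_measurable_continuous_onI[OF continuous_shift]
    by (intro measurable_restrict_space3) auto
  have "distr ?r ?r shift = distr ?r ?R shift" by (rule distr_cong) auto
  also have "\<dots> = return ?R (shift (\<lambda>_. 0))" by (rule distr_return[OF meas in_space])
  finally have "distr ?r ?r shift = ?r" by (simp add: shift_def)
  then show ?thesis
    using meas prob_space_return[OF in_space] by (simp add: invariant_measures_def)
qed

lemma locally_constant_potential: "locally_constant_on X (potential N)"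
  unfolding locally_constant_on_def locally_def
proof (intro allI impI)
  fix W x assume "openin (top_of_set X) W \<and> x \<in> W"
  then have W: "openin (top_of_set X) W" and x: "x \<in> W" by auto
  have "open {y :: nat \<Rightarrow> nat. y 0 = x 0}"
    by (rule open_determined[of 1]) (auto intro: determinedI)
  then have "openin (top_of_set X) (W \<inter> {y. y 0 = x 0})"
    using W by (metis Int_commute openin_Int_open)
  moreover have "potential N constant_on (W \<inter> {y. y 0 = x 0})"
    unfolding constant_on_def by (auto simp: potential_def)
  ultimately show "\<exists>U V. openin (top_of_set X) U \<and> potential N constant_on V \<and> x \<in> U \<and> U \<subseteq> V \<and> V \<subseteq> W"
    using x by (intro exI[of _ "W \<inter> {y. y 0 = x 0}"]) auto
qed

text \<open>Free energy is at most \<open>- one_prob\<close>, and the point mass attains 0. A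
  measure attaining 0 therefore has \<open>one_prob = 0\<close> and is the point mass.\<close>

lemma equilibrium_states_run_shift:
  assumes N: "2 \<le> N"
  shows "{\<mu>. equilibrium_state (run_shift N) (potential N) \<mu>}
    = {return (restrict_space borel (run_shift N)) (\<lambda>_. 0)}"
proof -
  let ?I = "invariant_measures (run_shift N)" and ?F = "free_energy (potential N)"
  let ?r = "return (restrict_space borel (run_shift N)) (\<lambda>_. 0)"
  have loc: "run_shift_measure N \<mu>" if "\<mu> \<in> ?I" for \<mu>
    using N that by (rule run_shift_measure.intro)
  have le: "?F \<mu> \<le> 0" if "\<mu> \<in> ?I" for \<mu>
  proof -
    interpret run_shift_measure N \<mu> using that by (rule loc)
    have "0 \<le> one_prob" by (simp add: one_prob_def)
    then have "ereal (- one_prob) \<le> 0" by simp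
    then show ?thesis using free_energy_le by (rule order_trans[rotated])
  qed
  have "0 \<le> ?F ?r"
  proof -
    interpret run_shift_measure N ?r using return_invariant by (rule loc)
    have "one_prob = 0"
      using coordinate_sets[of 0 1] unfolding one_prob_def by (subst measure_return) auto
    then show ?thesis unfolding free_energy_def integral_potential using measure_entropy_nonneg by simp
  qed
  then have sup: "(SUP \<nu>\<in>?I. ?F \<nu>) = 0"
    using le return_invariant by (intro antisym SUP_least) (auto intro: SUP_upper2)
  have "\<mu> = ?r" if "\<mu> \<in> ?I" "?F \<mu> = 0" for \<mu>
  proof -
    interpret run_shift_measure N \<mu> using that(1) by (rule loc)
    have "0 \<le> one_prob" by (simp add: one_prob_def)
    moreover have "one_prob \<le> 0" using free_energy_le unfolding that(2) by simp
    ultimately show ?thesis by (intro eq_return) simp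
  qed
  moreover have "?F ?r = 0" using le[OF return_invariant] \<open>0 \<le> ?F ?r\<close> by (rule antisym)
  ultimately show ?thesis
    unfolding equilibrium_state_def sup using return_invariant by auto
qed

theorem corollary1p8:
  fixes g :: "nat \<Rightarrow> nat"
  assumes "\<And>n. n \<ge> 1 \<Longrightarrow> g n \<ge> 1"
    and "mono_on {1..} g"
    and "Liminf sequentially (\<lambda>n. ereal (real (g n) / ln (real n))) > 0"
  shows "\<exists>(A :: nat set) (X :: (nat \<Rightarrow> nat) set) (G :: nat list set).
    shift_space A X \<and> topological_entropy X > 0 \<and>
    G \<subseteq> language X \<and> concatenations G \<subseteq> G \<and>
    hamming_approachable g (language X) G \<and>
    (\<exists>\<phi> :: (nat \<Rightarrow> nat) \<Rightarrow> real. locally_constant_on X \<phi> \<and>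
      (\<exists>x\<in>X. {\<mu>. equilibrium_state X \<phi> \<mu>} = {return (restrict_space borel X) x}))"
proof -
  obtain N where N: "2 \<le> N" "eventually (\<lambda>n. n \<le> N ^ g n) sequentially"
    using exponential_dominates[OF assms(3)] .
  have approach: "hamming_approachable g (language (run_shift N)) (free_words N)"
    unfolding language_run_shift[OF N(1)]
    by (rule hamming_approachable_free_words[OF N(1) assms(1) N(2)])
  show ?thesis
  proof (intro exI conjI bexI)
    show "free_words N \<subseteq> language (run_shift N)" using approach by (simp add: hamming_approachable_def)
  qed (rule shift_space_run_shift topological_entropy_run_shift N concatenations_free_words approach
      locally_constant_potential equilibrium_states_run_shift zero_run_shift)+
qed

end
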